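(* Let $S$ and $L$ be strings over the alphabet $\Sigma=[1..d]$, of lengths $n$ and $m\ge n$. For each $\alpha\in\Sigma$ let $n_\alpha$ be the number of occurrences of $\alpha$ in $S$ and $m_\alpha$ the number of occurrences of $\alpha$ in $L$ (so $n=\sum_\alpha n_\alpha$, $m=\sum_\alpha m_\alpha$), and let $g_\alpha=\min\{n_\alpha,m_\alpha-n_\alpha\}$. Let $\Sigma_+=\{\alpha\in\Sigma: g_\alpha>0\}$ if $g_\alpha=0$ for some $\alpha\in\Sigma$, and $\Sigma_+=\Sigma\setminus\{\arg\min_{\alpha\in\Sigma}g_\alpha\}$ otherwise. There is an algorithm computing the Swap-Insert Correction distance $\delta(S,L)$ in time within $O(d+m)$ if $S$ and $L$ have no symbol in common, and otherwise in time within \[ O\Big( d(n+m) + d^2 n\cdot \sum_{\alpha=1}^{d}(m_\alpha-g_\alpha)\cdot \prod_{\alpha\in\Sigma_+}(g_\alpha+1)\Big).\]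
   Context: The Swap-Insert Correction distance $\delta(S,L)$ is the minimum number of operations, each being either an insertion of a symbol at an arbitrary position or a swap of two adjacent symbols, that transform $S$ into $L$ ($+\infty$ if no such sequence exists).
   Formalization: The difference m_α−n_α in g_α is read as max{m_α−n_α,0}, so g_α=0 when α occurs more often in S than in L; taken literally, g_α is then negative and the stated time bound can become negative. The alphabet is assumed nonempty (d≥1). *)

theory Defs
  imports Main "HOL-Library.Extended_Nat"
begin

section \<open>The Swap-Insert Correction distance\<close>

text \<open>The inserted symbol is unconstrained: no operation deletes a symbol, so every symbol inserted
on the way to \<open>L\<close> occurs in \<open>L\<close> and hence belongs to the alphabet of \<open>L\<close>.\<close>

inductive swap_insert_op :: "'a list \<Rightarrow> 'a list \<Rightarrow> bool" where
  insertion: "swap_insert_op (xs @ ys) (xs @ a # ys)"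
| swap: "swap_insert_op (xs @ a # b # ys) (xs @ b # a # ys)"

text \<open>The infimum of the empty set of type \<open>enat\<close> is \<open>\<infinity>\<close>.\<close>

definition swap_insert_dist :: "'a list \<Rightarrow> 'a list \<Rightarrow> enat" where
  "swap_insert_dist S L = (INF k \<in> {k. (swap_insert_op ^^ k) S L}. enat k)"


section \<open>The parameters of the running time\<close>

text \<open>The subtraction is truncated: if \<open>\<alpha>\<close> occurs more often in \<open>S\<close> than in \<open>L\<close> (so that the distance
is \<open>\<infinity>\<close>), then \<open>gap S L \<alpha> = 0\<close>. Over the integers \<open>g\<^sub>\<alpha>\<close> would be negative there, and the bound
on the running time could itself become negative. There is no truncation in \<open>m\<^sub>\<alpha> - g\<^sub>\<alpha>\<close>.\<close>

definition gap :: "nat list \<Rightarrow> nat list \<Rightarrow> nat \<Rightarrow> nat" where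
  "gap S L \<alpha> = min (count_list S \<alpha>) (count_list L \<alpha> - count_list S \<alpha>)"

definition Sigma_plus :: "nat \<Rightarrow> nat list \<Rightarrow> nat list \<Rightarrow> nat set" where
  "Sigma_plus d S L =
     (if \<exists>\<alpha>\<in>{1..d}. gap S L \<alpha> = 0 then {\<alpha>\<in>{1..d}. gap S L \<alpha> > 0}
      else {1..d} - {arg_min_on (gap S L) {1..d}})"


section \<open>Algorithms: a random access machine with structured control\<close>

text \<open>
  A program works on finitely many named arrays of natural numbers, each indexed by all natural
  numbers and addressed indirectly; a scalar variable is cell \<open>0\<close> of an array. The only arithmetic
  is addition and truncated subtraction. In particular there is no multiplication, which at unit
  cost on unbounded numbers would be unreasonably powerful. Every constant, memory access,
  arithmetic operation, comparison, logical connective, assignment and branching test that is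
  executed costs one unit of time.
\<close>

type_synonym vname = string
type_synonym state = "vname \<Rightarrow> nat \<Rightarrow> nat"

datatype expr = Const nat | Cell vname expr | Add expr expr | Sub expr expr

datatype test = Less expr expr | Neg test | Conj test test

datatype prog =
    Skip
  | Assign vname expr expr
  | Seq prog prog
  | Cond test prog prog
  | Loop test prog

fun eval_expr :: "expr \<Rightarrow> state \<Rightarrow> nat" where
  "eval_expr (Const k) s = k"
| "eval_expr (Cell x e) s = s x (eval_expr e s)"
| "eval_expr (Add e f) s = eval_expr e s + eval_expr f s"
| "eval_expr (Sub e f) s = eval_expr e s - eval_expr f s"

fun cost_expr :: "expr \<Rightarrow> nat" where
  "cost_expr (Const k) = 1"
| "cost_expr (Cell x e) = 1 + cost_expr e"
| "cost_expr (Add e f) = 1 + cost_expr e + cost_expr f"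
| "cost_expr (Sub e f) = 1 + cost_expr e + cost_expr f"

fun eval_test :: "test \<Rightarrow> state \<Rightarrow> bool" where
  "eval_test (Less e f) s = (eval_expr e s < eval_expr f s)"
| "eval_test (Neg b) s = (\<not> eval_test b s)"
| "eval_test (Conj b c) s = (eval_test b s \<and> eval_test c s)"

fun cost_test :: "test \<Rightarrow> nat" where
  "cost_test (Less e f) = 1 + cost_expr e + cost_expr f"
| "cost_test (Neg b) = 1 + cost_test b"
| "cost_test (Conj b c) = 1 + cost_test b + cost_test c"

text \<open>\<open>exec p s t s'\<close>: started in state \<open>s\<close>, the program \<open>p\<close> halts in state \<open>s'\<close> after time \<open>t\<close>.
The command \<open>Assign x e f\<close> stores the value of \<open>f\<close> in cell \<open>e\<close> of the array \<open>x\<close>.\<close>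

inductive exec :: "prog \<Rightarrow> state \<Rightarrow> nat \<Rightarrow> state \<Rightarrow> bool" where
  exec_Skip: "exec Skip s 1 s"
| exec_Assign:
    "exec (Assign x e f) s (1 + cost_expr e + cost_expr f)
       (s(x := (s x)(eval_expr e s := eval_expr f s)))"
| exec_Seq: "exec p s t s' \<Longrightarrow> exec q s' u s'' \<Longrightarrow> exec (Seq p q) s (t + u) s''"
| exec_Cond_True:
    "eval_test b s \<Longrightarrow> exec p s t s' \<Longrightarrow> exec (Cond b p q) s (1 + cost_test b + t) s'"
| exec_Cond_False:
    "\<not> eval_test b s \<Longrightarrow> exec q s t s' \<Longrightarrow> exec (Cond b p q) s (1 + cost_test b + t) s'"
| exec_Loop_False: "\<not> eval_test b s \<Longrightarrow> exec (Loop b p) s (1 + cost_test b) s"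
| exec_Loop_True:
    "eval_test b s \<Longrightarrow> exec p s t s' \<Longrightarrow> exec (Loop b p) s' u s'' \<Longrightarrow>
     exec (Loop b p) s (1 + cost_test b + t + u) s''"

inductive_cases exec_SkipE: "exec Skip s t s'"
inductive_cases exec_AssignE: "exec (Assign x e f) s t s'"
inductive_cases exec_SeqE: "exec (Seq p q) s t s'"
inductive_cases exec_CondE: "exec (Cond b p q) s t s'"
inductive_cases exec_LoopE: "exec (Loop b p) s t s'"

lemma exec_deterministic: "exec p s t s' \<Longrightarrow> exec p s u s'' \<Longrightarrow> t = u \<and> s' = s''"
proof (induction arbitrary: u s'' rule: exec.induct)
  case exec_Skip
  then show ?case by (rule exec_SkipE) simp
next
  case exec_Assign
  then show ?case by (rule exec_AssignE) simp
next
  case (exec_Seq p s t s' q u s'' v r)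
  from exec_Seq.prems obtain t1 s1 u1
    where "v = t1 + u1" "exec p s t1 s1" "exec q s1 u1 r" by (rule exec_SeqE)
  moreover from this have "t = t1 \<and> s' = s1" by (intro exec_Seq.IH(1))
  moreover from calculation have "u = u1 \<and> s'' = r" by (intro exec_Seq.IH(2)) simp
  ultimately show ?case by simp
next
  case (exec_Cond_True b s p t s' q v r)
  from exec_Cond_True.prems exec_Cond_True.hyps(1) obtain t1
    where "v = 1 + cost_test b + t1" "exec p s t1 r" by (auto elim: exec_CondE)
  moreover from this have "t = t1 \<and> s' = r" by (intro exec_Cond_True.IH)
  ultimately show ?case by simp
next
  case (exec_Cond_False b s q t s' p v r)
  from exec_Cond_False.prems exec_Cond_False.hyps(1) obtain t1
    where "v = 1 + cost_test b + t1" "exec q s t1 r" by (auto elim: exec_CondE)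
  moreover from this have "t = t1 \<and> s' = r" by (intro exec_Cond_False.IH)
  ultimately show ?case by simp
next
  case exec_Loop_False
  from exec_Loop_False.prems show ?case
    by (rule exec_LoopE) (use exec_Loop_False.hyps in simp_all)
next
  case (exec_Loop_True b s p t s' u s'' v r)
  from exec_Loop_True.prems exec_Loop_True.hyps(1) obtain t1 s1 u1
    where "v = 1 + cost_test b + t1 + u1" "exec p s t1 s1" "exec (Loop b p) s1 u1 r"
    by (auto elim: exec_LoopE)
  moreover from this have "t = t1 \<and> s' = s1" by (intro exec_Loop_True.IH(1))
  moreover from calculation have "u = u1 \<and> s'' = r" by (intro exec_Loop_True.IH(2)) simp
  ultimately show ?case by simp
qed

text \<open>The symbols of the strings are stored in cells \<open>0, 1, \<dots>\<close>; all other cells initially contain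
\<open>0\<close>. A finite result is returned in \<open>out\<close>, and a nonzero value of \<open>inf\<close> signals \<open>\<infinity>\<close>.\<close>

definition scalar :: "nat \<Rightarrow> nat \<Rightarrow> nat" where
  "scalar k = (\<lambda>i. if i = 0 then k else 0)"

definition symbols :: "nat list \<Rightarrow> nat \<Rightarrow> nat" where
  "symbols w = (\<lambda>i. if i < length w then w ! i else 0)"

definition input_state :: "nat \<Rightarrow> nat list \<Rightarrow> nat list \<Rightarrow> state" where
  "input_state d S L = (\<lambda>_ _. 0)
     (''d'' := scalar d, ''n'' := scalar (length S), ''m'' := scalar (length L),
      ''S'' := symbols S, ''L'' := symbols L)"

definition result_of :: "state \<Rightarrow> enat" where
  "result_of s = (if s ''inf'' 0 = 0 then enat (s ''out'' 0) else \<infinity>)"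

end

theory Submission
  imports Defs
begin

text \<open>
  Reading \<open>L\<close> from left to right, the next symbol \<open>a\<close> of \<open>L\<close> is either inserted, at cost 1, or it is
  the first \<open>a\<close> among the symbols of \<open>S\<close> not matched so far, which has to be swapped past all the
  unmatched symbols in front of it. A configuration of this process is determined by the length of
  the prefix of \<open>L\<close> read so far and, for every symbol \<open>b\<close>, the number \<open>k\<^sub>b\<close> of matched occurrences.
  If \<open>c\<^sub>b\<close> is the number of occurrences in the prefix, then
  \<open>max 0 (c\<^sub>b - (m\<^sub>b - n\<^sub>b)) \<le> k\<^sub>b \<le> min c\<^sub>b n\<^sub>b\<close>, so \<open>k\<^sub>b\<close> takes at most \<open>g\<^sub>b + 1\<close> values. Hence there are
  at most \<open>(m + 1) * (\<Prod>b. g\<^sub>b + 1)\<close> configurations, and each is evaluated in time \<open>O(d)\<close>. If \<open>\<Sigma>\<^sub>+\<close>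
  omits a positive \<open>g\<^sub>b\<close>, then \<open>g\<^sub>b + 1 \<le> 2 * n\<close> pays for the missing factor,
  and \<open>m \<le> 2 * (\<Sum>b. m\<^sub>b - g\<^sub>b)\<close>.
\<close>

section \<open>A recursion for the distance\<close>

fun si_cost :: "'a list \<Rightarrow> 'a list \<Rightarrow> enat" where
  "si_cost R [] = (if R = [] then 0 else \<infinity>)"
| "si_cost R (a # w) =
     min (1 + si_cost R w)
       (if a \<in> set R then enat (length (takeWhile (\<lambda>x. x \<noteq> a) R)) + si_cost (remove1 a R) w
        else \<infinity>)"

lemma takeWhile_first: "a \<notin> set xs \<Longrightarrow> takeWhile (\<lambda>x. x \<noteq> a) (xs @ a # ys) = xs"
  by (induction xs) auto

lemma si_cost_insert_le: "si_cost R (a # w) \<le> 1 + si_cost R w"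
  by simp

lemma si_cost_match_le:
  "a \<notin> set xs \<Longrightarrow> si_cost (xs @ a # ys) (a # w) \<le> enat (length xs) + si_cost (xs @ ys) w"
  by (simp add: remove1_append takeWhile_first)

lemma si_cost_Cons_cases:
  obtains (insert) "si_cost R (a # w) = 1 + si_cost R w"
  | (match) xs ys where "R = xs @ a # ys" "a \<notin> set xs"
      "si_cost R (a # w) = enat (length xs) + si_cost (xs @ ys) w"
proof (cases "a \<in> set R")
  case False
  then show ?thesis using insert by simp
next
  case True
  then obtain xs ys where R: "R = xs @ a # ys" "a \<notin> set xs"
    by (meson split_list_first)
  then have "si_cost R (a # w) = min (1 + si_cost R w) (enat (length xs) + si_cost (xs @ ys) w)"
    by (simp add: remove1_append takeWhile_first)
  then show ?thesis
    by (metis insert match[OF R] min_def)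
qed

lemma append_eq_append_Cons_notin:
  assumes "xs @ zs = us @ a # vs" "a \<notin> set xs"
  obtains us' where "us = xs @ us'" "zs = us' @ a # vs"
  using assms by (induction xs arbitrary: us) (auto simp: Cons_eq_append_conv)

lemma split_first_unique:
  assumes "xs @ a # ys = us @ a # vs" "a \<notin> set xs" "a \<notin> set us"
  shows "us = xs \<and> vs = ys"
proof -
  obtain us' where "us = xs @ us'" "a # ys = us' @ a # vs"
    using assms(1,2) by (rule append_eq_append_Cons_notin)
  with assms(3) show ?thesis by (cases us') auto
qed

lemma enat_le_step: "x \<le> c + y \<Longrightarrow> y \<le> 1 + z \<Longrightarrow> x \<le> 1 + (c + z)" for x y z c :: enat
  using order_trans[OF _ add_left_mono[of y "1 + z" c]] by (simp add: add.left_commute)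

lemma enat_le_1_plus: "x \<le> y \<Longrightarrow> x \<le> 1 + y" for x y :: enat
  using add_increasing[of 1 x y] by simp

lemma si_cost_insertion: "si_cost (xs @ ys) L \<le> 1 + si_cost (xs @ b # ys) L"
proof (induction L arbitrary: xs ys)
  case Nil
  then show ?case by simp
next
  case (Cons a w)
  show ?case
  proof (cases rule: si_cost_Cons_cases[of "xs @ b # ys" a w])
    case insert
    then show ?thesis
      using enat_le_step[OF si_cost_insert_le Cons.IH[of xs ys]] by simp
  next
    case (match us vs)
    show ?thesis
    proof (cases "a \<in> set xs")
      case True
      then obtain us' vs' where xs: "xs = us' @ a # vs'" "a \<notin> set us'"
        by (meson split_list_first)
      with match(1,2) have "us = us' \<and> vs = vs' @ b # ys"
        using split_first_unique[of us' a "vs' @ b # ys" us vs] by simp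
      with match(3) xs
        enat_le_step[OF si_cost_match_le[of a us' "vs' @ ys" w], of "si_cost (us' @ vs' @ b # ys) w"]
        Cons.IH[of "us' @ vs'" ys]
      show ?thesis
        by (simp del: si_cost.simps)
    next
      case nxs: False
      show ?thesis
      proof (cases "a = b")
        case True
        with nxs match(1,2) have "us = xs \<and> vs = ys"
          using split_first_unique[of xs a ys us vs] by simp
        with match(3) show ?thesis
          using order_trans[OF si_cost_insert_le add_left_mono[OF add_increasing[OF zero_le order_refl]]]
          by (simp del: si_cost.simps)
      next
        case False
        with nxs match(1) obtain us' where us: "us = xs @ b # us'" "ys = us' @ a # vs"
          using append_eq_append_Cons_notin[of "xs @ [b]" ys us a vs] by auto
        with match(2) si_cost_match_le[of a "xs @ us'" vs w]
        have "si_cost (xs @ ys) (a # w) \<le> enat (length xs + length us') + si_cost (xs @ us' @ vs) w"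
          by simp
        also have "\<dots> \<le> enat (length xs + length us') + (1 + si_cost (xs @ b # us' @ vs) w)"
          using Cons.IH[of xs "us' @ vs"] by (rule add_left_mono)
        also have "\<dots> = si_cost (xs @ b # ys) (a # w)"
          using match(3) us
          by (simp del: si_cost.simps add: add.assoc[symmetric] one_enat_def)
        finally show ?thesis
          by (rule enat_le_1_plus)
      qed
    qed
  qed
qed

lemma si_cost_swap: "si_cost (xs @ b # c # ys) L \<le> 1 + si_cost (xs @ c # b # ys) L"
proof (induction L arbitrary: xs ys)
  case Nil
  then show ?case by simp
next
  case (Cons a w)
  show ?case
  proof (cases rule: si_cost_Cons_cases[of "xs @ c # b # ys" a w])
    case insert
    then show ?thesis
      using enat_le_step[OF si_cost_insert_le Cons.IH[of xs ys]] by simp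
  next
    case (match us vs)
    show ?thesis
    proof (cases "a \<in> set xs")
      case True
      then obtain us' vs' where xs: "xs = us' @ a # vs'" "a \<notin> set us'"
        by (meson split_list_first)
      with match(1,2) have "us = us' \<and> vs = vs' @ c # b # ys"
        using split_first_unique[of us' a "vs' @ c # b # ys" us vs] by simp
      with match(3) xs
        enat_le_step[OF si_cost_match_le[of a us' "vs' @ b # c # ys" w],
          of "si_cost (us' @ vs' @ c # b # ys) w"]
        Cons.IH[of "us' @ vs'" ys]
      show ?thesis
        by (simp del: si_cost.simps)
    next
      case nxs: False
      consider (eq) "b = c" | (fst) "b \<noteq> c" "a = c" | (snd) "b \<noteq> c" "a = b"
        | (later) "a \<noteq> b" "a \<noteq> c"
        by blast
      then show ?thesis
      proof cases
        case eq
        then show ?thesis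
          by (simp add: enat_le_1_plus del: si_cost.simps)
      next
        case fst
        with nxs match(1,2) have "us = xs \<and> vs = b # ys"
          using split_first_unique[of xs a "b # ys" us vs] by simp
        with fst nxs match(3) si_cost_match_le[of a "xs @ [b]" ys w] show ?thesis
          by (simp del: si_cost.simps add: add.assoc[symmetric] one_enat_def)
      next
        case snd
        with nxs match(1,2) have "us = xs @ [c] \<and> vs = ys"
          using split_first_unique[of "xs @ [c]" a ys us vs] by simp
        with snd nxs match(3) si_cost_match_le[of a xs "c # ys" w]
        have "si_cost (xs @ b # c # ys) (a # w) \<le> enat (length xs) + si_cost (xs @ c # ys) w"
          and "si_cost (xs @ c # b # ys) (a # w) = 1 + (enat (length xs) + si_cost (xs @ c # ys) w)"
          by (simp_all del: si_cost.simps add: add.assoc[symmetric] one_enat_def)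
        then show ?thesis
          by (simp add: enat_le_1_plus del: si_cost.simps)
      next
        case later
        with nxs match(1) obtain us' where us: "us = xs @ c # b # us'" "ys = us' @ a # vs"
          using append_eq_append_Cons_notin[of "xs @ [c, b]" ys us a vs] by auto
        with match(2) si_cost_match_le[of a "xs @ b # c # us'" vs w]
        have "si_cost (xs @ b # c # ys) (a # w) \<le> enat (length us) + si_cost (xs @ b # c # us' @ vs) w"
          by (simp del: si_cost.simps)
        also have "\<dots> \<le> enat (length us) + (1 + si_cost (xs @ c # b # us' @ vs) w)"
          using Cons.IH[of xs "us' @ vs"] by (rule add_left_mono)
        also have "\<dots> = 1 + si_cost (xs @ c # b # ys) (a # w)"
          using match(3) us by (simp del: si_cost.simps add: add.left_commute)
        finally show ?thesis .
      qed
    qed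
  qed
qed

lemma si_cost_refl: "si_cost L L = 0"
  by (induction L) (simp_all add: zero_enat_def[symmetric])

lemma si_cost_le: "(swap_insert_op ^^ k) S L \<Longrightarrow> si_cost S L \<le> enat k"
proof (induction k arbitrary: S)
  case 0
  then show ?case by (simp add: si_cost_refl)
next
  case (Suc k)
  then obtain S' where S': "swap_insert_op S S'" "(swap_insert_op ^^ k) S' L"
    by (meson relpowp_Suc_E2)
  from S'(1) have "si_cost S L \<le> 1 + si_cost S' L"
    by cases (simp_all add: si_cost_insertion si_cost_swap)
  also have "\<dots> \<le> 1 + enat k"
    using Suc.IH[OF S'(2)] by (rule add_left_mono)
  finally show ?case
    by (simp add: one_enat_def)
qed

lemma swap_insert_op_Cons: "swap_insert_op S L \<Longrightarrow> swap_insert_op (a # S) (a # L)"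
proof (induction rule: swap_insert_op.induct)
  case (insertion xs ys b)
  then show ?case using swap_insert_op.insertion[of "a # xs"] by simp
next
  case (swap xs b c ys)
  then show ?case using swap_insert_op.swap[of "a # xs"] by simp
qed

lemma relpowp_swap_insert_op_Cons:
  "(swap_insert_op ^^ k) S L \<Longrightarrow> (swap_insert_op ^^ k) (a # S) (a # L)"
proof (induction k arbitrary: L)
  case (Suc k)
  then show ?case by (metis relpowp_Suc_E relpowp_Suc_I swap_insert_op_Cons)
qed simp

lemma relpowp_swap_to_front: "(swap_insert_op ^^ length xs) (xs @ a # ys) (a # xs @ ys)"
proof (induction xs)
  case (Cons x xs)
  have "(swap_insert_op ^^ length xs) (x # xs @ a # ys) (x # a # xs @ ys)"
    using Cons.IH by (rule relpowp_swap_insert_op_Cons)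
  moreover have "swap_insert_op (x # a # xs @ ys) (a # x # xs @ ys)"
    using swap_insert_op.swap[of "[]"] by simp
  ultimately show ?case by (auto intro: relpowp_Suc_I)
qed simp

lemma relpowp_of_si_cost: "si_cost S L = enat k \<Longrightarrow> (swap_insert_op ^^ k) S L"
proof (induction L arbitrary: S k)
  case Nil
  then show ?case by (auto split: if_splits simp: zero_enat_def)
next
  case (Cons a w)
  show ?case
  proof (cases rule: si_cost_Cons_cases[of S a w])
    case insert
    with Cons.prems obtain l where l: "si_cost S w = enat l" "k = Suc l"
      by (cases "si_cost S w") (simp_all del: si_cost.simps add: one_enat_def)
    have "swap_insert_op S (a # S)"
      using swap_insert_op.insertion[of "[]"] by simp
    then show ?thesis
      unfolding l(2) using relpowp_swap_insert_op_Cons[OF Cons.IH[OF l(1)]]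
      by (rule relpowp_Suc_I2)
  next
    case (match xs ys)
    with Cons.prems obtain l where l: "si_cost (xs @ ys) w = enat l" "k = length xs + l"
      by (cases "si_cost (xs @ ys) w") (simp_all del: si_cost.simps)
    show ?thesis
      unfolding l(2) match(1) relpowp_add
      using relpowp_swap_to_front[of xs a ys] relpowp_swap_insert_op_Cons[OF Cons.IH[OF l(1)]]
      by blast
  qed
qed

lemma swap_insert_dist_eq_si_cost: "swap_insert_dist S L = si_cost S L"
  unfolding swap_insert_dist_def
proof (rule antisym)
  show "si_cost S L \<le> (INF k \<in> {k. (swap_insert_op ^^ k) S L}. enat k)"
    by (auto intro: INF_greatest si_cost_le)
  show "(INF k \<in> {k. (swap_insert_op ^^ k) S L}. enat k) \<le> si_cost S L"
  proof (cases "si_cost S L")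
    case (enat k)
    then show ?thesis
      using relpowp_of_si_cost[of S L k] by (auto intro: INF_lower)
  qed simp
qed

lemma count_list_le_if_si_cost: "si_cost R w \<noteq> \<infinity> \<Longrightarrow> count_list R b \<le> count_list w b"
proof (induction w arbitrary: R)
  case (Cons a w)
  show ?case
  proof (cases rule: si_cost_Cons_cases[of R a w])
    case insert
    with Cons.prems have "si_cost R w \<noteq> \<infinity>" by (metis plus_eq_infty_iff_enat)
    from Cons.IH[OF this] show ?thesis by simp
  next
    case (match xs ys)
    with Cons.prems have "si_cost (xs @ ys) w \<noteq> \<infinity>" by (metis plus_eq_infty_iff_enat)
    from Cons.IH[OF this] show ?thesis by (simp add: match(1))
  qed
qed (auto split: if_splits)

fun drop_occ :: "('a \<Rightarrow> nat) \<Rightarrow> 'a list \<Rightarrow> 'a list" where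
  "drop_occ k [] = []"
| "drop_occ k (a # s) =
     (if k a = 0 then a # drop_occ k s else drop_occ (k(a := k a - 1)) s)"

lemma drop_occ_0: "drop_occ (\<lambda>_. 0) s = s"
  by (induction s) simp_all

lemma count_list_drop_occ: "count_list (drop_occ k s) b = count_list s b - k b"
  by (induction s arbitrary: k) auto

lemma drop_occ_append:
  "drop_occ k (xs @ ys) = drop_occ k xs @ drop_occ (\<lambda>b. k b - count_list xs b) ys"
proof (induction xs arbitrary: k)
  case (Cons a xs)
  show ?case
  proof (cases "k a = 0")
    case True
    then have "(\<lambda>b. k b - count_list (a # xs) b) = (\<lambda>b. k b - count_list xs b)"
      by (auto simp: fun_eq_iff)
    with True show ?thesis by (simp only: append_Cons drop_occ.simps simp_thms if_True Cons.IH)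
  next
    case False
    then have "(\<lambda>b. k b - count_list (a # xs) b) = (\<lambda>b. (k(a := k a - 1)) b - count_list xs b)"
      by auto
    with False show ?thesis by (simp only: append_Cons drop_occ.simps if_False Cons.IH)
  qed
qed simp

lemma remove1_drop_occ: "remove1 a (drop_occ k s) = drop_occ (k(a := Suc (k a))) s"
proof (induction s arbitrary: k)
  case (Cons b s)
  show ?case
  proof (cases "a = b")
    case True
    have "k(b := 0) = k" if "k b = 0" using that by auto
    then show ?thesis
      using True Cons.IH[of "k(b := k b - 1)"]
      by (cases "k b = 0") (simp_all del: fun_upd_apply add: fun_upd_same)
  next
    case False
    then show ?thesis
      using Cons.IH[of k] Cons.IH[of "k(b := k b - 1)"]
      by (simp del: fun_upd_apply add: fun_upd_other fun_upd_twist)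
  qed
qed simp

lemma length_drop_occ:
  assumes "finite A" "set s \<subseteq> A"
  shows "length (drop_occ k s) = (\<Sum>b\<in>A. count_list s b - k b)"
proof -
  have "set (drop_occ k s) \<subseteq> A"
  proof -
    have "set (drop_occ k s) \<subseteq> set s"
      by (induction s arbitrary: k) (auto split: if_splits)
    with assms(2) show ?thesis by blast
  qed
  then have "(\<Sum>b\<in>A. count_list (drop_occ k s) b) = length (drop_occ k s)"
    using assms(1) by (metis sum_count_set)
  then show ?thesis by (simp add: count_list_drop_occ)
qed

lemma takeWhile_drop_occ:
  assumes "s = xs @ a # ys" "count_list xs a = k a"
  shows "takeWhile (\<lambda>x. x \<noteq> a) (drop_occ k s) = drop_occ k xs"
proof -
  have "count_list (drop_occ k xs) a = 0"
    by (simp add: count_list_drop_occ assms(2))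
  then have "a \<notin> set (drop_occ k xs)"
    by (simp add: count_list_0_iff)
  then show ?thesis
    using assms by (simp add: drop_occ_append takeWhile_first)
qed

text \<open>The recursion behind the dynamic program: \<open>p\<close> is the position in \<open>S\<close> of the first \<open>a\<close> that
is still unmatched, and the unmatched symbols in front of it have to be crossed.\<close>

lemma si_cost_drop_occ:
  assumes "finite A" "set S \<subseteq> A" and le: "\<And>b. count_list S b \<le> k b + count_list (a # w) b"
    and pos: "k a < count_list S a \<Longrightarrow>
      p < length S \<and> S ! p = a \<and> count_list (take p S) a = k a"
  defines "ins \<equiv> 1 + si_cost (drop_occ k S) w"
    and "mat \<equiv> enat (\<Sum>b\<in>A. count_list (take p S) b - k b) +
      si_cost (drop_occ (k(a := Suc (k a))) S) w"
  shows "si_cost (drop_occ k S) (a # w) =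
    (if k a < count_list S a
     then if count_list S a \<le> k a + count_list w a then min ins mat else mat
     else ins)"
proof -
  have mem: "a \<in> set (drop_occ k S) \<longleftrightarrow> k a < count_list S a"
    by (metis count_list_0_iff count_list_drop_occ zero_less_diff neq0_conv)
  have ins: "ins = \<infinity>" if "\<not> count_list S a \<le> k a + count_list w a"
    using count_list_le_if_si_cost[of "drop_occ k S" w a] that
    by (cases "si_cost (drop_occ k S) w") (simp_all add: ins_def count_list_drop_occ)
  show ?thesis
  proof (cases "k a < count_list S a")
    case True
    with pos have p: "p < length S" "S ! p = a" "count_list (take p S) a = k a"
      by auto
    then have "S = take p S @ a # drop (Suc p) S"
      using id_take_nth_drop[of p S] by simp
    from takeWhile_drop_occ[OF this, of k] p(3)
    have "length (takeWhile (\<lambda>x. x \<noteq> a) (drop_occ k S)) =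
        (\<Sum>b\<in>A. count_list (take p S) b - k b)"
      using length_drop_occ[OF assms(1), of "take p S"] assms(2) set_take_subset[of p S] by auto
    with True mem ins show ?thesis
      by (simp add: remove1_drop_occ mat_def ins_def[symmetric])
  next
    case False
    with mem show ?thesis by (simp add: ins_def)
  qed
qed

section \<open>Weakest preconditions with running time\<close>

definition wp :: "prog \<Rightarrow> state \<Rightarrow> (nat \<Rightarrow> state \<Rightarrow> bool) \<Rightarrow> bool" where
  "wp p s Q = (\<exists>t s'. exec p s t s' \<and> Q t s')"

lemma wp_Skip [simp]: "wp Skip s Q = Q 1 s"
  unfolding wp_def by (metis exec_Skip exec_deterministic)

lemma wp_Assign [simp]:
  "wp (Assign x e f) s Q =
     Q (1 + cost_expr e + cost_expr f) (s(x := (s x)(eval_expr e s := eval_expr f s)))"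
  unfolding wp_def by (metis exec_Assign exec_deterministic)

lemma wp_Seq [simp]: "wp (Seq p q) s Q = wp p s (\<lambda>t s'. wp q s' (\<lambda>u. Q (t + u)))"
  unfolding wp_def
proof safe
  fix t s'' assume "exec (Seq p q) s t s''" "Q t s''"
  then show "\<exists>t s'. exec p s t s' \<and> (\<exists>u s''. exec q s' u s'' \<and> Q (t + u) s'')"
    by (elim exec_SeqE) auto
next
  fix t s' u s'' assume "exec p s t s'" "exec q s' u s''" "Q (t + u) s''"
  then show "\<exists>t s'. exec (Seq p q) s t s' \<and> Q t s'"
    by (blast intro: exec_Seq)
qed

lemma wp_Cond [simp]:
  "wp (Cond b p q) s Q =
     (if eval_test b s then wp p s (\<lambda>t. Q (1 + cost_test b + t))
      else wp q s (\<lambda>t. Q (1 + cost_test b + t)))"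
proof (cases "eval_test b s")
  case True
  then show ?thesis
    unfolding wp_def using exec_Cond_True[OF True] by (auto elim!: exec_CondE) blast
next
  case False
  then show ?thesis
    unfolding wp_def using exec_Cond_False[OF False] by (auto elim!: exec_CondE) blast
qed

fun writes :: "prog \<Rightarrow> vname set" where
  "writes Skip = {}"
| "writes (Assign x e f) = {x}"
| "writes (Seq p q) = writes p \<union> writes q"
| "writes (Cond b p q) = writes p \<union> writes q"
| "writes (Loop b p) = writes p"

fun reads :: "expr \<Rightarrow> vname set" where
  "reads (Const k) = {}"
| "reads (Cell x e) = insert x (reads e)"
| "reads (Add e f) = reads e \<union> reads f"
| "reads (Sub e f) = reads e \<union> reads f"

lemma exec_frame: "exec p s t s' \<Longrightarrow> x \<notin> writes p \<Longrightarrow> s' x = s x"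
  by (induction rule: exec.induct) auto

lemma eval_expr_cong: "(\<And>x. x \<in> reads e \<Longrightarrow> s x = s' x) \<Longrightarrow> eval_expr e s = eval_expr e s'"
  by (induction e) auto

lemma wp_frame:
  assumes "wp p s Q" and "\<And>t s'. Q t s' \<Longrightarrow> \<forall>x. x \<notin> writes p \<longrightarrow> s' x = s x \<Longrightarrow> R t s'"
  shows "wp p s R"
  using assms unfolding wp_def by (meson exec_frame)

lemma wp_mono: "wp p s Q \<Longrightarrow> (\<And>t s'. Q t s' \<Longrightarrow> R t s') \<Longrightarrow> wp p s R"
  unfolding wp_def by blast

lemma wp_Loop:
  assumes "\<And>s. I N s \<Longrightarrow> \<not> eval_test b s"
    and "\<And>k s. k < N \<Longrightarrow> I k s \<Longrightarrow> eval_test b s \<and> wp p s (\<lambda>t s'. t \<le> T \<and> I (Suc k) s')"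
  shows "k \<le> N \<Longrightarrow> I k s \<Longrightarrow>
    wp (Loop b p) s (\<lambda>t s'. t \<le> (N - k) * (1 + cost_test b + T) + 1 + cost_test b \<and> I N s')"
proof (induction "N - k" arbitrary: k s)
  case 0
  then have "k = N" by simp
  with 0 assms(1) have "exec (Loop b p) s (1 + cost_test b) s"
    by (intro exec_Loop_False) simp
  with 0 \<open>k = N\<close> show ?case unfolding wp_def by (intro exI conjI) auto
next
  case (Suc j)
  from Suc(2) have "k < N" by simp
  from assms(2)[OF this Suc.prems(2)]
  have "eval_test b s" and "wp p s (\<lambda>t s'. t \<le> T \<and> I (Suc k) s')"
    by simp_all
  then obtain t s' where t: "exec p s t s'" "t \<le> T" "I (Suc k) s'"
    unfolding wp_def by blast
  have "wp (Loop b p) s' (\<lambda>t s''.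
      t \<le> (N - Suc k) * (1 + cost_test b + T) + 1 + cost_test b \<and> I N s'')"
    using Suc.hyps(2) \<open>k < N\<close> t(3) by (intro Suc.hyps(1)) simp_all
  then obtain u s'' where u: "exec (Loop b p) s' u s''" "I N s''"
      "u \<le> (N - Suc k) * (1 + cost_test b + T) + 1 + cost_test b"
    unfolding wp_def by blast
  have "(N - k) * (1 + cost_test b + T) = (1 + cost_test b + T) + (N - Suc k) * (1 + cost_test b + T)"
    using \<open>k < N\<close> by (metis Suc_diff_Suc mult_Suc)
  with t(2) u(3) have "1 + cost_test b + t + u \<le> (N - k) * (1 + cost_test b + T) + 1 + cost_test b"
    by linarith
  with exec_Loop_True[OF \<open>eval_test b s\<close> t(1) u(1)] u(2) show ?case
    unfolding wp_def by (intro exI conjI)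
qed

abbreviation var :: "vname \<Rightarrow> expr" where
  "var x \<equiv> Cell x (Const 0)"

abbreviation set_var :: "vname \<Rightarrow> expr \<Rightarrow> prog" where
  "set_var x e \<equiv> Assign x (Const 0) e"

definition For :: "vname \<Rightarrow> expr \<Rightarrow> prog \<Rightarrow> prog" where
  "For i e p = Seq (set_var i (Const 0))
     (Loop (Less (var i) e) (Seq p (set_var i (Add (var i) (Const 1)))))"

lemma writes_For [simp]: "writes (For i e p) = insert i (writes p)"
  by (auto simp: For_def)

lemma wp_For:
  assumes "i \<notin> writes p" "reads e \<inter> insert i (writes p) = {}"
    and init: "I 0 (s0(i := (s0 i)(0 := 0)))"
    and step: "\<And>k s. k < eval_expr e s0 \<Longrightarrow> I k s \<Longrightarrow> s i 0 = k \<Longrightarrow>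
      \<forall>x. x \<notin> insert i (writes p) \<longrightarrow> s x = s0 x \<Longrightarrow>
      wp p s (\<lambda>t s'. t \<le> T \<and> I (Suc k) (s'(i := (s' i)(0 := Suc k))))"
    and post: "\<And>t s. t \<le> eval_expr e s0 * (T + cost_expr e + 10) + cost_expr e + 7 \<Longrightarrow>
      I (eval_expr e s0) s \<Longrightarrow>
      \<forall>x. x \<notin> insert i (writes p) \<longrightarrow> s x = s0 x \<Longrightarrow> Q t s"
  shows "wp (For i e p) s0 Q"
proof -
  let ?N = "eval_expr e s0" and ?b = "Less (var i) e"
  let ?p = "Seq p (set_var i (Add (var i) (Const 1)))"
  let ?F = "\<lambda>s. \<forall>x. x \<notin> insert i (writes p) \<longrightarrow> s x = s0 x"
  let ?J = "\<lambda>k s. I k s \<and> s i 0 = k \<and> ?F s"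
  let ?s = "s0(i := (s0 i)(0 := 0))"
  have e: "eval_expr e s = ?N" if "?F s" for s
    using that assms(2) by (intro eval_expr_cong) blast
  have "wp (Loop ?b ?p) ?s
      (\<lambda>t s'. t \<le> (?N - 0) * (1 + cost_test ?b + (T + 6)) + 1 + cost_test ?b \<and> ?J ?N s')"
  proof (rule wp_Loop)
    fix s assume "?J ?N s"
    with e[of s] show "\<not> eval_test ?b s" by simp
  next
    fix k s assume k: "k < ?N" and J: "?J k s"
    have "wp p s (\<lambda>t s'. wp (set_var i (Add (var i) (Const 1))) s'
        (\<lambda>u s''. t + u \<le> T + 6 \<and> ?J (Suc k) s''))"
    proof (rule wp_frame)
      show "wp p s (\<lambda>t s'. t \<le> T \<and> I (Suc k) (s'(i := (s' i)(0 := Suc k))))"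
        using k J by (intro step) simp_all
    next
      fix t s'
      assume "t \<le> T \<and> I (Suc k) (s'(i := (s' i)(0 := Suc k)))"
        and F: "\<forall>x. x \<notin> writes p \<longrightarrow> s' x = s x"
      moreover have "s' i = s i" using F assms(1) by simp
      moreover have "?F (s'(i := (s' i)(0 := Suc k)))"
        using F J by simp
      ultimately show "wp (set_var i (Add (var i) (Const 1))) s'
          (\<lambda>u s''. t + u \<le> T + 6 \<and> ?J (Suc k) s'')"
        using J by simp
    qed
    moreover have "eval_test ?b s" using k J e[of s] by simp
    ultimately show "eval_test ?b s \<and> wp ?p s (\<lambda>t s'. t \<le> T + 6 \<and> ?J (Suc k) s')"
      by simp
  next
    show "?J 0 ?s" using init by (intro conjI) simp_all
  qed simp
  then have "wp (Loop ?b ?p) ?s (\<lambda>t. Q (3 + t))"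
  proof (rule wp_mono, intro post)
    fix t s
    assume "t \<le> (?N - 0) * (1 + cost_test ?b + (T + 6)) + 1 + cost_test ?b \<and> ?J ?N s"
    then show "3 + t \<le> ?N * (T + cost_expr e + 10) + cost_expr e + 7"
      by (simp add: algebra_simps)
  qed blast+
  then show ?thesis
    by (simp add: For_def numeral_3_eq_3)
qed


section \<open>Mixed radix digits\<close>

definition weight :: "(nat \<Rightarrow> nat) \<Rightarrow> nat \<Rightarrow> nat" where
  "weight g b = (\<Prod>c<b. g c + 1)"

definition digit :: "(nat \<Rightarrow> nat) \<Rightarrow> nat \<Rightarrow> nat \<Rightarrow> nat" where
  "digit g z b = (z div weight g b) mod (g b + 1)"

lemma weight_0 [simp]: "weight g 0 = 1"
  by (simp add: weight_def)

lemma weight_Suc: "weight g (Suc b) = weight g b * (g b + 1)"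
  by (simp add: weight_def)

lemma weight_pos [simp]: "weight g b > 0"
  by (simp add: weight_def prod_pos)

lemma weight_dvd: "a \<le> b \<Longrightarrow> weight g a dvd weight g b"
  unfolding weight_def by (rule prod_dvd_prod_subset) auto

lemma digit_le: "digit g z b \<le> g b"
  unfolding digit_def using mod_less_divisor[of "g b + 1"] by (simp add: less_Suc_eq_le)

lemma digit_0 [simp]: "digit g 0 b = 0"
  by (simp add: digit_def)

lemma digit_add_weight_higher: "b < a \<Longrightarrow> digit g (z + weight g a) b = digit g z b"
proof -
  assume "b < a"
  then obtain c where "weight g a = weight g b * ((g b + 1) * c)"
    using weight_dvd[of "Suc b" a g] by (metis Suc_leI dvdE mult.assoc weight_Suc)
  then show ?thesis
    by (simp only: digit_def div_mult_self2 mod_mult_self4 weight_pos[THEN less_imp_neq, symmetric]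
        not_False_eq_True)
qed

lemma div_add_weight_lower:
  assumes "digit g z a < g a" "a < b"
  shows "(z + weight g a) div weight g b = z div weight g b"
proof -
  have "(z + weight g a) div weight g (Suc a) = Suc (z div weight g a) div (g a + 1)"
    by (simp only: weight_Suc div_mult2_eq) simp
  also have "\<dots> = z div weight g (Suc a)"
    using assms(1) by (simp only: weight_Suc div_mult2_eq) (simp add: digit_def div_Suc mod_Suc)
  finally have *: "(z + weight g a) div weight g (Suc a) = z div weight g (Suc a)" .
  obtain c where "weight g b = weight g (Suc a) * c"
    using weight_dvd[of "Suc a" b g] assms(2) by (auto simp: dvd_def)
  then show ?thesis using * by (simp add: div_mult2_eq)
qed

lemma digit_add_weight:
  assumes "digit g z a < g a"
  shows "digit g (z + weight g a) b = digit g z b + (if b = a then 1 else 0)"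
proof -
  consider "b < a" | "b = a" | "a < b" by linarith
  then show ?thesis
  proof cases
    case 2
    with assms show ?thesis by (simp add: digit_def mod_Suc)
  next
    case 3
    then show ?thesis using div_add_weight_lower[OF assms 3] by (simp add: digit_def)
  qed (simp add: digit_add_weight_higher)
qed

lemma digit_sub_weight:
  assumes "0 < digit g z a"
  obtains y where "z = y + weight g a" "digit g y a < g a"
proof
  have "z div weight g a \<noteq> 0"
    using assms by (metis digit_def mod_0 less_irrefl)
  then have le: "weight g a \<le> z"
    by (simp add: div_eq_0_iff)
  then show z: "z = (z - weight g a) + weight g a" by simp
  have "z div weight g a = Suc ((z - weight g a) div weight g a)"
    using le by (simp add: le_div_geq)
  then have "digit g z a = (if Suc (digit g (z - weight g a) a) = g a + 1 then 0
      else Suc (digit g (z - weight g a) a))"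
    by (simp add: digit_def mod_Suc)
  with assms digit_le[of g "z - weight g a" a] show "digit g (z - weight g a) a < g a"
    by (auto split: if_splits)
qed

lemma digit_Suc:
  "digit g (Suc z) b =
     (if Suc (z mod weight g b) = weight g b
      then if digit g z b = g b then 0 else Suc (digit g z b)
      else digit g z b)"
  by (simp add: digit_def div_Suc mod_Suc)

section \<open>The dynamic program\<close>

locale alignment =
  fixes d :: nat and S L :: "nat list"
  assumes S_le: "set S \<subseteq> {..d}" and L_le: "set L \<subseteq> {..d}"
    and count_le: "count_list S b \<le> count_list L b"
begin

abbreviation g :: "nat \<Rightarrow> nat" where
  "g \<equiv> gap S L"

abbreviation r :: "nat \<Rightarrow> nat" where
  "r b \<equiv> count_list L b - count_list S b"

abbreviation T :: nat where
  "T \<equiv> weight g (Suc d)"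

definition pre :: "nat \<Rightarrow> nat \<Rightarrow> nat" where
  "pre \<rho> = count_list (take (length L - \<rho>) L)"

text \<open>Cell \<open>z\<close> of the table belongs to row \<open>z div T\<close>, where row \<open>\<rho>\<close> stands for the suffix of \<open>L\<close> of length
\<open>\<rho>\<close>, and the digits of \<open>z\<close> encode how far each \<open>k\<^sub>b\<close> exceeds its smallest possible value
\<open>c\<^sub>b - r\<^sub>b\<close> (truncated). The rows are filled in the order of increasing \<open>\<rho>\<close>, and row \<open>0\<close> is already
correct in zero-initialised memory.\<close>

definition config :: "nat \<Rightarrow> nat \<Rightarrow> nat" where
  "config z b = digit g z b + (pre (z div T) b - r b)"

text \<open>Cells with \<open>k\<^sub>b > c\<^sub>b\<close> for some \<open>b\<close> are unreachable and hold arbitrary values.\<close>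

definition good :: "nat \<Rightarrow> nat \<Rightarrow> bool" where
  "good z v \<longleftrightarrow> ((\<forall>b. config z b \<le> pre (z div T) b) \<longrightarrow>
     enat v = si_cost (drop_occ (config z) S) (drop (length L - z div T) L))"

lemma g_eq: "g b = min (count_list S b) (r b)"
  by (simp add: gap_def)

lemma pre_le: "pre \<rho> b \<le> count_list L b"
  unfolding pre_def by (metis append_take_drop_id count_list_append le_add1)

lemma count_list_drop: "pre \<rho> b + count_list (drop (length L - \<rho>) L) b = count_list L b"
  unfolding pre_def by (metis append_take_drop_id count_list_append)

lemma good_base: "z < T \<Longrightarrow> good z 0"
proof -
  assume "z < T"
  then have "z div T = 0" by simp
  then have "config z b \<ge> count_list S b" for b
    using count_le[of b] by (simp add: config_def pre_def)
  then have "count_list (drop_occ (config z) S) b = 0" for b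
    by (simp add: count_list_drop_occ)
  then have "drop_occ (config z) S = []"
    by (metis count_list_0_iff list.set_intros(1) neq_Nil_conv)
  then show ?thesis
    by (simp add: good_def \<open>z div T = 0\<close> zero_enat_def)
qed

lemma good_step:
  assumes z: "z div T = Suc i" and i: "i < length L" and x: "x = L ! (length L - 1 - i)"
    and V: "\<And>y. y < z \<Longrightarrow> good y (V y)"
    and p: "config z x < count_list S x \<Longrightarrow>
      p < length S \<and> S ! p = x \<and> count_list (take p S) x = config z x"
    and ins: "ins = V (if pre (Suc i) x < r x then z - T else z - T - weight g x) + 1"
    and mat: "config z x < count_list S x \<Longrightarrow> mat =
      V (if pre (Suc i) x < r x then z - T + weight g x else z - T) +
      (\<Sum>b\<le>d. count_list (take p S) b - config z b)"
  shows "good z (if config z x < count_list S x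
    then if pre (Suc i) x < config z x + r x \<and> ins < mat then ins else mat else ins)"
proof (cases "\<forall>b. config z b \<le> pre (Suc i) b")
  case False
  then show ?thesis unfolding good_def z by blast
next
  case valid: True
  define k c where "k = config z" and "c = pre (Suc i)"
  define y where "y = z - T"
  have zy: "z = y + T"
    unfolding y_def using z by (cases "z < T") auto
  have ydiv: "y div T = i"
    using z unfolding zy by simp
  have digit_y: "digit g z b = digit g y b" for b
  proof (cases "b \<le> d")
    case True
    then show ?thesis
      using digit_add_weight_higher[of b "Suc d" g y] unfolding zy by simp
  next
    case False
    with S_le have "b \<notin> set S" by auto
    then have "g b = 0" by (simp add: gap_def count_list_0_iff)
    then show ?thesis by (simp add: digit_def)
  qed
  have k: "k b = digit g z b + (c b - r b)" "k b \<le> c b" for b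
    using valid by (simp_all add: k_def c_def config_def z)
  have "x \<in> set L" using x i by simp
  with L_le have "x < Suc d" by auto
  have L: "drop (length L - Suc i) L = x # drop (length L - i) L"
    using i x Cons_nth_drop_Suc[of "length L - Suc i" L] by (simp add: Suc_diff_Suc)
  have take: "take (length L - i) L = take (length L - Suc i) L @ [x]"
    using i x take_Suc_conv_app_nth[of "length L - Suc i" L] by (simp add: Suc_diff_Suc)
  have c_Suc: "pre i b = c b + (if b = x then 1 else 0)" for b
    by (simp add: pre_def c_def take)
  have c_x: "c x < count_list L x"
    using pre_le[of i x] c_Suc[of x] by simp
  have use_V: "enat (V q) = si_cost (drop_occ k' S) (drop (length L - i) L)"
    if "q div T = i" "\<And>b. digit g q b + (pre i b - r b) = k' b" "\<And>b. k' b \<le> pre i b" for q k'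
  proof -
    have "q < z"
      using that(1) z by (metis Suc_n_not_le_n div_le_mono not_less)
    from V[OF this] show ?thesis
      using that by (simp add: good_def config_def[abs_def])
  qed
  define M where "M = (if c x < r x then z - T + weight g x else z - T)"
  define I where "I = (if c x < r x then z - T else z - T - weight g x)"
  have zT: "z - T = y" by (simp add: y_def)
  have M: "enat (V M) = si_cost (drop_occ (k(x := Suc (k x))) S) (drop (length L - i) L)"
    if "k x < count_list S x"
  proof (cases "c x < r x")
    case True
    with k[of x] that have "digit g y x < g x"
      by (simp add: digit_y[symmetric] g_eq)
    with \<open>x < Suc d\<close> True show ?thesis
      using k k(2)[of x] by (intro use_V)
        (auto simp: M_def zT div_add_weight_lower ydiv digit_add_weight digit_y c_Suc le_SucI)
  next
    case False
    then show ?thesis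
      using k k(2)[of x] by (intro use_V) (auto simp: M_def zT ydiv digit_y c_Suc Suc_diff_le le_SucI)
  qed
  have I: "enat (V I) = si_cost (drop_occ k S) (drop (length L - i) L)"
    if "c x < k x + r x"
  proof (cases "c x < r x")
    case True
    then show ?thesis
      using k k(2)[of x] by (intro use_V) (auto simp: I_def zT ydiv digit_y c_Suc le_SucI)
  next
    case False
    with that k[of x] have "0 < digit g y x"
      by (simp add: digit_y[symmetric])
    then obtain y' where y': "y = y' + weight g x" "digit g y' x < g x"
      by (rule digit_sub_weight)
    have "I = y'"
      using False y'(1) by (simp add: I_def zT)
    show ?thesis
    proof (rule use_V)
      show "I div T = i"
        using ydiv div_add_weight_lower[OF y'(2) \<open>x < Suc d\<close>] y'(1) \<open>I = y'\<close> by simp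
      show "digit g I b + (pre i b - r b) = k b" for b
        using False k(1)[of b] digit_add_weight[OF y'(2), of b] y'(1) \<open>I = y'\<close>
        by (simp add: digit_y c_Suc Suc_diff_le)
      show "k b \<le> pre i b" for b
        using k(2)[of b] by (simp add: c_Suc)
    qed
  qed
  let ?w = "drop (length L - i) L"
  let ?ins = "1 + si_cost (drop_occ k S) ?w"
  let ?cross = "\<Sum>b\<le>d. count_list (take p S) b - k b"
  let ?mat = "enat ?cross + si_cost (drop_occ (k(x := Suc (k x))) S) ?w"
  have count_w: "count_list L b = c b + count_list (x # ?w) b" for b
    using count_list_drop[of "Suc i" b] by (simp add: c_def L)
  have rec: "si_cost (drop_occ k S) (x # ?w) =
    (if k x < count_list S x
     then if count_list S x \<le> k x + count_list ?w x then min ?ins ?mat else ?mat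
     else ?ins)"
  proof (rule si_cost_drop_occ)
    show "count_list S b \<le> k b + count_list (x # ?w) b" for b
      using count_w[of b] count_le[of b] k(1)[of b] by linarith
  qed (use S_le p in \<open>auto simp: k_def\<close>)
  have cond: "count_list S x \<le> k x + count_list ?w x \<longleftrightarrow> c x < k x + r x"
    using count_w[of x] count_le[of x] by auto
  have ins': "enat ins = ?ins" if "c x < k x + r x"
  proof -
    have "ins = 1 + V I" by (simp add: ins I_def c_def)
    then show ?thesis by (simp add: I[OF that, symmetric] one_enat_def)
  qed
  have mat': "enat mat = ?mat" if "k x < count_list S x"
  proof -
    have "mat = ?cross + V M" using mat that by (simp add: M_def c_def k_def)
    then show ?thesis by (simp add: M[OF that, symmetric])
  qed
  have "c x < k x + r x" if "\<not> k x < count_list S x"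
    using that c_x by linarith
  then have "enat (if k x < count_list S x
      then if c x < k x + r x \<and> ins < mat then ins else mat else ins) =
      si_cost (drop_occ k S) (x # ?w)"
    unfolding rec cond by (auto simp: min_def simp flip: ins' mat')
  then show ?thesis
    unfolding good_def z L k_def c_def by blast
qed

end

section \<open>Preprocessing of the strings\<close>

notation Seq (infixr ";;" 60)

definition count_prog :: "vname \<Rightarrow> vname \<Rightarrow> vname \<Rightarrow> prog" where
  "count_prog A X N = For ''i'' (var N)
     (Assign A (Cell X (var ''i'')) (Add (Cell A (Cell X (var ''i''))) (Const (Suc 0))))"

lemma count_list_take_Suc:
  "k < length w \<Longrightarrow>
    count_list (take (Suc k) w) b = count_list (take k w) b + (if b = w ! k then 1 else 0)"
  by (simp add: take_Suc_conv_app_nth)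

lemma wp_count_prog:
  assumes "distinct [''i'', A, X, N]" "s A = (\<lambda>_. 0)" "s X = symbols w" "s N 0 = length w"
    and post: "\<And>t s'. t \<le> 22 * length w + 9 \<Longrightarrow> s' A = count_list w \<Longrightarrow>
      \<forall>x. x \<notin> {''i'', A} \<longrightarrow> s' x = s x \<Longrightarrow> Q t s'"
  shows "wp (count_prog A X N) s Q"
  unfolding count_prog_def
proof (rule wp_For[where I = "\<lambda>k s. s A = count_list (take k w)" and T = 10])
  fix k s' assume k: "k < eval_expr (var N) s" "s' A = count_list (take k w)" "s' ''i'' 0 = k"
    and "\<forall>x. x \<notin> insert ''i'' (writes
      (Assign A (Cell X (var ''i'')) (Add (Cell A (Cell X (var ''i''))) (Const (Suc 0))))) \<longrightarrow> s' x = s x"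
  then have "s' X = symbols w" using assms by auto
  with k assms show "wp (Assign A (Cell X (var ''i'')) (Add (Cell A (Cell X (var ''i''))) (Const (Suc 0))))
      s' (\<lambda>t s'. t \<le> 10 \<and> (s'(''i'' := (s' ''i'')(0 := Suc k))) A = count_list (take (Suc k) w))"
    by (auto simp: symbols_def count_list_take_Suc)
qed (use assms in auto)

definition check_prog :: prog where
  "check_prog = For ''i'' (var ''d'')
     (Cond (Less (Cell ''b'' (Add (var ''i'') (Const (Suc 0)))) (Cell ''a'' (Add (var ''i'') (Const (Suc 0)))))
       (set_var ''inf'' (Const (Suc 0))) Skip)"

lemma wp_check_prog:
  assumes "s ''inf'' 0 = 0"
    and post: "\<And>t s'. t \<le> 27 * s ''d'' 0 + 9 \<Longrightarrow>
      s' ''inf'' 0 = 0 \<longleftrightarrow> (\<forall>b\<in>{1..s ''d'' 0}. s ''a'' b \<le> s ''b'' b) \<Longrightarrow>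
      \<forall>x. x \<notin> {''i'', ''inf''} \<longrightarrow> s' x = s x \<Longrightarrow> Q t s'"
  shows "wp check_prog s Q"
  unfolding check_prog_def
proof (rule wp_For[where T = 15 and
    I = "\<lambda>k s'. s' ''inf'' 0 = 0 \<longleftrightarrow> (\<forall>b\<in>{1..k}. s ''a'' b \<le> s ''b'' b)"], goal_cases)
  case (4 k s')
  then show ?case by (auto simp: atLeastAtMostSuc_conv)
qed (use assms in auto)

definition row :: "nat \<Rightarrow> nat \<Rightarrow> nat" where
  "row d p = p * Suc d"

definition rows_prog :: prog where
  "rows_prog = For ''i'' (var ''n'')
     (Assign ''r'' (Add (var ''i'') (Const (Suc 0)))
       (Add (Cell ''r'' (var ''i'')) (Add (var ''d'') (Const (Suc 0)))))"

lemma row_0 [simp]: "row d 0 = 0"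
  by (simp add: row_def)

lemma row_Suc: "row d (Suc p) = row d p + Suc d"
  by (simp add: row_def)

lemma wp_rows_prog:
  assumes "s ''r'' 0 = 0"
    and post: "\<And>t s'. t \<le> 30 * s ''n'' 0 + 9 \<Longrightarrow>
      \<forall>p\<le>s ''n'' 0. s' ''r'' p = row (s ''d'' 0) p \<Longrightarrow>
      \<forall>x. x \<notin> {''i'', ''r''} \<longrightarrow> s' x = s x \<Longrightarrow> Q t s'"
  shows "wp rows_prog s Q"
  unfolding rows_prog_def
proof (rule wp_For[where T = 15 and I = "\<lambda>k s'. \<forall>p\<le>k. s' ''r'' p = row (s ''d'' 0) p"], goal_cases)
  case (4 k s')
  then show ?case by (auto simp: le_Suc_eq row_Suc)
qed (use assms in auto)

definition copy_row_prog :: prog where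
  "copy_row_prog = For ''k'' (Add (var ''d'') (Const (Suc 0)))
     (Assign ''c'' (Add (Cell ''r'' (Add (var ''i'') (Const (Suc 0)))) (var ''k''))
       (Cell ''c'' (Add (Cell ''r'' (var ''i'')) (var ''k''))))"

lemma writes_copy_row_prog [simp]: "writes copy_row_prog = {''k'', ''c''}"
  by (auto simp: copy_row_prog_def)

text \<open>Pairs \<open>(q, b)\<close> with \<open>b \<le> d\<close> are stored in cell \<open>q * (d + 1) + b\<close>; the products are looked up in the
array \<open>r\<close>. Then \<open>c\<close> counts the occurrences of \<open>b\<close> among the first \<open>q\<close> symbols of \<open>S\<close>, and \<open>P\<close> holds the
position in \<open>S\<close> of occurrence number \<open>q\<close> of \<open>b\<close>, counted from \<open>0\<close>.\<close>

definition tables_prog :: prog where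
  "tables_prog = For ''i'' (var ''n'')
     (set_var ''x'' (Cell ''S'' (var ''i'')) ;;
      Assign ''P''
        (Add (Cell ''r'' (Cell ''c'' (Add (Cell ''r'' (var ''i'')) (var ''x'')))) (var ''x''))
        (var ''i'') ;;
      copy_row_prog ;;
      Assign ''c'' (Add (Cell ''r'' (Add (var ''i'') (Const (Suc 0)))) (var ''x''))
        (Add (Cell ''c'' (Add (Cell ''r'' (Add (var ''i'') (Const (Suc 0)))) (var ''x''))) (Const (Suc 0))))"

lemma pair_index_eq_iff:
  fixes b b' d :: nat
  assumes "b \<le> d" "b' \<le> d"
  shows "row d q + b = row d q' + b' \<longleftrightarrow> q = q' \<and> b = b'"
proof
  assume eq: "row d q + b = row d q' + b'"
  have "(row d q + b) div Suc d = q" "(row d q' + b') div Suc d = q'"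
    using assms by (simp_all add: row_def div_add1_eq del: mult_Suc_right)
  with eq show "q = q' \<and> b = b'" by simp
qed simp

definition counts_upto :: "nat \<Rightarrow> nat list \<Rightarrow> (nat \<Rightarrow> nat) \<Rightarrow> nat \<Rightarrow> bool" where
  "counts_upto d S c p \<longleftrightarrow> (\<forall>q\<le>p. \<forall>b\<le>d. c (row d q + b) = count_list (take q S) b)"

definition positions_upto :: "nat \<Rightarrow> nat list \<Rightarrow> (nat \<Rightarrow> nat) \<Rightarrow> nat \<Rightarrow> bool" where
  "positions_upto d S P p \<longleftrightarrow>
     (\<forall>a\<le>d. \<forall>k<count_list (take p S) a. P (row d k + a) < p \<and>
        S ! P (row d k + a) = a \<and> count_list (take (P (row d k + a)) S) a = k)"

lemma positions_upto_Suc: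
  assumes "positions_upto d S P p" "p < length S" "S ! p \<le> d"
  shows "positions_upto d S (P(row d (count_list (take p S) (S ! p)) + S ! p := p)) (Suc p)"
  unfolding positions_upto_def
proof (intro allI impI)
  fix a k assume a: "a \<le> d" and k: "k < count_list (take (Suc p) S) a"
  let ?k = "count_list (take p S) (S ! p)"
  let ?P = "P(row d ?k + S ! p := p)"
  show "?P (row d k + a) < Suc p \<and> S ! ?P (row d k + a) = a \<and>
    count_list (take (?P (row d k + a)) S) a = k"
  proof (cases "k = ?k \<and> a = S ! p")
    case True
    then show ?thesis by simp
  next
    case False
    with pair_index_eq_iff[of a d "S ! p" k ?k] a assms(3)
    have "row d k + a \<noteq> row d ?k + S ! p" by blast
    then have "?P (row d k + a) = P (row d k + a)" by simp
    moreover have "k < count_list (take p S) a"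
      using k False assms(2) by (auto simp: count_list_take_Suc split: if_splits)
    then have "P (row d k + a) < p \<and> S ! P (row d k + a) = a \<and>
        count_list (take (P (row d k + a)) S) a = k"
      using assms(1) a unfolding positions_upto_def by blast
    ultimately show ?thesis by simp
  qed
qed

lemma counts_upto_Suc:
  assumes "counts_upto d S c p" "p < length S" "S ! p \<le> d"
    and "\<forall>q\<le>p. \<forall>b\<le>d. c' (row d q + b) = c (row d q + b)"
    and "\<forall>b\<le>d. c' (row d (Suc p) + b) = c (row d p + b)"
  shows "counts_upto d S
    (c'(row d (Suc p) + S ! p := Suc (c' (row d (Suc p) + S ! p)))) (Suc p)"
  unfolding counts_upto_def
proof (intro allI impI)
  fix q b assume q: "q \<le> Suc p" and b: "b \<le> d"
  let ?c = "c'(row d (Suc p) + S ! p := Suc (c' (row d (Suc p) + S ! p)))"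
  have c: "c (row d q + b) = count_list (take q S) b" if "q \<le> p" for q
    using assms(1) b that by (simp add: counts_upto_def)
  have upd: "?c (row d q + b) = c' (row d q + b) + (if q = Suc p \<and> b = S ! p then 1 else 0)"
    using pair_index_eq_iff[of b d "S ! p" q "Suc p"] b assms(3)
    by auto
  show "?c (row d q + b) = count_list (take q S) b"
  proof (cases "q = Suc p")
    case True
    with upd b assms(5) c[of p] show ?thesis
      by (auto simp: count_list_take_Suc[OF assms(2)])
  next
    case False
    with q have "q \<le> p" by simp
    with False upd b assms(4) c[of q] show ?thesis by simp
  qed
qed

lemma wp_copy_row:
  assumes r: "s ''r'' p = row d p" "s ''r'' (Suc p) = row d (Suc p)"
    and s: "s ''d'' 0 = d" "s ''i'' 0 = p"
    and post: "\<And>t s'. t \<le> 125 * Suc d \<Longrightarrow>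
      \<forall>q\<le>p. \<forall>b\<le>d. s' ''c'' (row d q + b) = s ''c'' (row d q + b) \<Longrightarrow>
      \<forall>b\<le>d. s' ''c'' (row d (Suc p) + b) = s ''c'' (row d p + b) \<Longrightarrow>
      \<forall>x. x \<notin> {''k'', ''c''} \<longrightarrow> s' x = s x \<Longrightarrow> Q t s'"
  shows "wp copy_row_prog s Q"
  unfolding copy_row_prog_def
proof (rule wp_For[where T = 50 and I = "\<lambda>k s'.
    (\<forall>q\<le>p. \<forall>b\<le>d. s' ''c'' (row d q + b) = s ''c'' (row d q + b)) \<and>
    (\<forall>b<k. s' ''c'' (row d (Suc p) + b) = s ''c'' (row d p + b))"], goal_cases)
  case (4 k s')
  then have k: "k \<le> d" using s by simp
  have neq: "row d q + b \<noteq> row d (Suc p) + k" if "q \<le> p" "b \<le> d" for q b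
    using pair_index_eq_iff[of b d k q "Suc p"] that k by simp
  have "s' ''c'' (row d p + k) = s ''c'' (row d p + k)"
    using 4 k by blast
  moreover have "s' ''r'' = s ''r''" "s' ''i'' = s ''i''"
    using 4 by simp_all
  ultimately show ?case
    using 4 neq k r s by (simp add: less_Suc_eq)
next
  case (5 t s')
  from 5(1) s have "t \<le> 125 * Suc d" by simp
  with 5 show ?case
    using s by (intro post) (simp_all add: less_Suc_eq_le)
qed (use assms in auto)

lemma wp_tables_prog:
  assumes S: "set S \<subseteq> {..d}"
    and s: "s ''d'' 0 = d" "s ''n'' 0 = length S" "s ''S'' = symbols S"
      "s ''c'' = (\<lambda>_. 0)" "\<forall>p\<le>length S. s ''r'' p = row d p"
    and post: "\<And>t s'. t \<le> 250 * Suc d * length S + 9 \<Longrightarrow>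
      counts_upto d S (s' ''c'') (length S) \<Longrightarrow> positions_upto d S (s' ''P'') (length S) \<Longrightarrow>
      \<forall>x. x \<notin> {''i'', ''k'', ''x'', ''P'', ''c''} \<longrightarrow> s' x = s x \<Longrightarrow> Q t s'"
  shows "wp tables_prog s Q"
  unfolding tables_prog_def
proof (rule wp_For[where T = "125 * Suc d + 60" and
    I = "\<lambda>p s'. counts_upto d S (s' ''c'') p \<and> positions_upto d S (s' ''P'') p"], goal_cases)
  case (4 p s')
  then have p: "p < length S" and C: "counts_upto d S (s' ''c'') p" and P: "positions_upto d S (s' ''P'') p"
    and F: "s' ''i'' 0 = p" "s' ''r'' = s ''r''" "s' ''S'' = s ''S''" "s' ''d'' 0 = d" "s' ''n'' = s ''n''"
    using s by simp_all
  have x: "S ! p \<le> d" using S p nth_mem by blast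
  have r: "s ''r'' q = row d q" if "q \<le> length S" for q
    using s that by simp
  have cnt: "s' ''c'' (row d p + S ! p) = count_list (take p S) (S ! p)"
    using C x by (simp add: counts_upto_def)
  have "count_list (take p S) (S ! p) \<le> length S"
    using count_le_length[of "take p S" "S ! p"] p by simp
  note r' = r[OF this] r[OF less_imp_le[OF p]] r[OF Suc_leI[OF p]]
  show ?case
    apply (simp add: symbols_def F s p r' cnt)
    apply (rule wp_copy_row[where p = p and d = d])
        apply (simp_all add: F s r' cnt)[4]
    subgoal for t s''
      using counts_upto_Suc[OF C p x, of "s'' ''c''"] positions_upto_Suc[OF P p x]
      by (simp add: F s r' cnt)
    done
next
  case (5 t s')
  then show ?case using s by (intro post) (simp_all add: algebra_simps)
qed (use assms in \<open>auto simp: counts_upto_def positions_upto_def\<close>)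

definition fill_weight_prog :: prog where
  "fill_weight_prog = For ''j'' (Add (Cell ''g'' (var ''i'')) (Const (Suc 0)))
     (Assign ''w'' (Add (var ''i'') (Const (Suc 0)))
       (Add (Cell ''w'' (Add (var ''i'') (Const (Suc 0)))) (Cell ''w'' (var ''i''))))"

lemma writes_fill_weight_prog [simp]: "writes fill_weight_prog = {''j'', ''w''}"
  by (auto simp: fill_weight_prog_def)

lemma wp_fill_weight_prog:
  assumes "s ''i'' 0 = b" "s ''w'' (Suc b) = 0"
    and post: "\<And>t s'. t \<le> 50 * Suc (s ''g'' b) \<Longrightarrow>
      s' ''w'' = (s ''w'')(Suc b := Suc (s ''g'' b) * s ''w'' b) \<Longrightarrow>
      \<forall>x. x \<notin> {''j'', ''w''} \<longrightarrow> s' x = s x \<Longrightarrow> Q t s'"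
  shows "wp fill_weight_prog s Q"
  unfolding fill_weight_prog_def
proof (rule wp_For[where T = 20 and I = "\<lambda>k s'. s' ''w'' = (s ''w'')(Suc b := k * s ''w'' b)"],
    goal_cases)
  case 3
  then show ?case using assms(2) by (simp add: fun_eq_iff)
next
  case (4 k s')
  then show ?case using assms(1) by (simp add: add.commute)
next
  case (5 t s')
  then show ?case using assms(1) by (intro post) simp_all
qed simp_all

definition weights_prog :: prog where
  "weights_prog = Assign ''w'' (Const 0) (Const (Suc 0)) ;;
     For ''i'' (Add (var ''d'') (Const (Suc 0)))
       (Assign ''h'' (var ''i'') (Sub (Cell ''b'' (var ''i'')) (Cell ''a'' (var ''i''))) ;;
        Cond (Less (Cell ''a'' (var ''i'')) (Cell ''h'' (var ''i'')))
          (Assign ''g'' (var ''i'') (Cell ''a'' (var ''i'')))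
          (Assign ''g'' (var ''i'') (Cell ''h'' (var ''i''))) ;;
        fill_weight_prog)"

context alignment
begin

lemma wp_weights_prog:
  assumes s: "s ''d'' 0 = d" "s ''a'' = count_list S" "s ''b'' = count_list L" "s ''w'' = (\<lambda>_. 0)"
    and post: "\<And>t s'. t \<le> 150 * (Suc d * Suc (length S)) \<Longrightarrow>
      \<forall>b\<le>d. s' ''g'' b = g b \<and> s' ''h'' b = r b \<Longrightarrow>
      \<forall>b\<le>Suc d. s' ''w'' b = weight g b \<Longrightarrow>
      \<forall>x. x \<notin> {''i'', ''j'', ''g'', ''h'', ''w''} \<longrightarrow> s' x = s x \<Longrightarrow> Q t s'"
  shows "wp weights_prog s Q"
  unfolding weights_prog_def wp_Seq wp_Assign
proof (rule wp_For[where T = "50 * Suc (length S) + 50" and I = "\<lambda>k s'.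
    (\<forall>b<k. s' ''g'' b = g b \<and> s' ''h'' b = r b) \<and> (\<forall>b\<le>k. s' ''w'' b = weight g b) \<and>
    (\<forall>b>k. s' ''w'' b = 0)"], goal_cases)
  case (4 k s')
  then have F: "s' ''a'' = count_list S" "s' ''b'' = count_list L" "s' ''i'' 0 = k"
    using s by simp_all
  have I: "s' ''g'' b = g b" "s' ''h'' b = r b" if "b < k" for b
    using 4(2) that by simp_all
  have w: "s' ''w'' b = weight g b" if "b \<le> k" for b
    using 4(2) that by simp
  have w0: "s' ''w'' b = 0" if "k < b" for b
    using 4(2) that by simp
  have g: "g k = count_list S k" if "count_list S k < r k"
    using that by (simp add: gap_def)
  have g': "g k = r k" if "\<not> count_list S k < r k"
    using that by (simp add: gap_def)
  have gk: "count_list S k \<le> length S"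
    by (rule count_le_length)
  show ?case
    using gk
    apply (simp add: F)
    apply (intro conjI impI; rule wp_fill_weight_prog[where b = k])
         apply (simp_all add: F I w w0 g g' less_Suc_eq le_Suc_eq weight_Suc)
    done
next
  case (5 t s')
  define X where "X = Suc d * Suc (length S)"
  have "Suc d \<le> X" "1 \<le> Suc d" by (simp_all add: X_def)
  moreover have "t \<le> 14 + (50 * X + 64 * Suc d)"
    using 5(1) s by (simp add: X_def algebra_simps)
  ultimately have "3 + t \<le> 150 * X"
    by simp
  with 5 show ?case using s by (intro post) (simp_all add: less_Suc_eq_le X_def)
qed (use s in auto)

end

definition crossings_prog :: prog where
  "crossings_prog = For ''k'' (Add (var ''d'') (Const (Suc 0)))
     (set_var ''y'' (Add (var ''y'')
       (Sub (Cell ''c'' (Add (Cell ''r'' (var ''q'')) (var ''k'')))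
         (Add (Cell ''D'' (var ''k'')) (Sub (Cell ''b'' (var ''k'')) (Cell ''h'' (var ''k'')))))))"

lemma writes_crossings_prog [simp]: "writes crossings_prog = {''k'', ''y''}"
  by (auto simp: crossings_prog_def)

lemma wp_crossings_prog:
  assumes "s ''y'' 0 = 0"
    and post: "\<And>t s'. t \<le> 125 * Suc (s ''d'' 0) \<Longrightarrow>
      s' ''y'' 0 = (\<Sum>b\<le>s ''d'' 0. s ''c'' (s ''r'' (s ''q'' 0) + b) -
        (s ''D'' b + (s ''b'' b - s ''h'' b))) \<Longrightarrow>
      \<forall>x. x \<notin> {''k'', ''y''} \<longrightarrow> s' x = s x \<Longrightarrow> Q t s'"
  shows "wp crossings_prog s Q"
  unfolding crossings_prog_def
proof (rule wp_For[where T = 50 and I = "\<lambda>k s'. s' ''y'' 0 =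
    (\<Sum>b<k. s ''c'' (s ''r'' (s ''q'' 0) + b) - (s ''D'' b + (s ''b'' b - s ''h'' b)))"],
    goal_cases)
  case (5 t s')
  then show ?case by (intro post) (simp_all add: lessThan_Suc_atMost)
qed (use assms in auto)

text \<open>Each digit keeps its own counter modulo its weight, so that no carry has to be propagated.\<close>

definition odometer_prog :: prog where
  "odometer_prog = For ''k'' (Add (var ''d'') (Const (Suc 0)))
     (Assign ''u'' (var ''k'') (Add (Cell ''u'' (var ''k'')) (Const (Suc 0))) ;;
      Cond (Less (Cell ''u'' (var ''k'')) (Cell ''w'' (var ''k''))) Skip
        (Assign ''u'' (var ''k'') (Const 0) ;;
         Assign ''D'' (var ''k'') (Add (Cell ''D'' (var ''k'')) (Const (Suc 0))) ;;
         Cond (Less (Cell ''g'' (var ''k'')) (Cell ''D'' (var ''k'')))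
           (Assign ''D'' (var ''k'') (Const 0)) Skip))"

lemma writes_odometer_prog [simp]: "writes odometer_prog = {''k'', ''u'', ''D''}"
  by (auto simp: odometer_prog_def)

definition odometer_shows :: "(nat \<Rightarrow> nat) \<Rightarrow> nat \<Rightarrow> state \<Rightarrow> nat \<Rightarrow> bool" where
  "odometer_shows g d s z \<longleftrightarrow>
     (\<forall>b\<le>d. s ''D'' b = digit g z b \<and> s ''u'' b = z mod weight g b)"

lemma wp_odometer_prog:
  assumes s: "s ''d'' 0 = d" "\<forall>b\<le>d. s ''g'' b = g b" "\<forall>b\<le>d. s ''w'' b = weight g b"
      "odometer_shows g d s z"
    and post: "\<And>t s'. t \<le> 125 * Suc d \<Longrightarrow> odometer_shows g d s' (Suc z) \<Longrightarrow>
      \<forall>x. x \<notin> {''k'', ''u'', ''D''} \<longrightarrow> s' x = s x \<Longrightarrow> Q t s'"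
  shows "wp odometer_prog s Q"
  unfolding odometer_prog_def
proof (rule wp_For[where T = 50 and I = "\<lambda>k s'. \<forall>b\<le>d.
    s' ''D'' b = digit g (if b < k then Suc z else z) b \<and>
    s' ''u'' b = (if b < k then Suc z else z) mod weight g b"], goal_cases)
  case (4 k s')
  then have k: "k \<le> d" using s(1) by simp
  have F: "s' ''g'' k = g k" "s' ''w'' k = weight g k" "s' ''i'' = s ''i''"
    using 4 k s by simp_all
  have D: "s' ''D'' k = digit g z k" "s' ''u'' k = z mod weight g k"
    using 4(2) k by simp_all
  have lt: "z mod weight g k < weight g k"
    by simp
  have c: "Suc (z mod weight g k) < weight g k \<longleftrightarrow> Suc (z mod weight g k) \<noteq> weight g k"
    using lt by linarith
  have d: "g k < Suc (digit g z k) \<longleftrightarrow> digit g z k = g k"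
    using digit_le[of g z k] by linarith
  show ?case
    using 4(2,3) k
    by (simp add: F D c d digit_le[THEN leD] digit_Suc[of g z k] mod_Suc less_Suc_eq split del: if_split split: if_splits)
next
  case (5 t s')
  then show ?case using s
    by (intro post) (simp_all add: odometer_shows_def less_Suc_eq_le)
qed (use s in \<open>auto simp: odometer_shows_def\<close>)

section \<open>Evaluation of the table\<close>

definition index_prog :: prog where
  "index_prog =
     Cond (Less (Cell ''b'' (var ''x'')) (Cell ''h'' (var ''x'')))
       (set_var ''I'' (Sub (var ''z'') (var ''T'')) ;;
        set_var ''M'' (Add (Sub (var ''z'') (var ''T'')) (Cell ''w'' (var ''x''))))
       (set_var ''I'' (Sub (Sub (var ''z'') (var ''T'')) (Cell ''w'' (var ''x''))) ;;
        set_var ''M'' (Sub (var ''z'') (var ''T'')))"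

lemma writes_index_prog [simp]: "writes index_prog = {''I'', ''M''}"
  by (auto simp: index_prog_def)

lemma wp_index_prog:
  assumes s: "s ''x'' 0 = x" "s ''z'' 0 = z" "s ''T'' 0 = T"
    and post: "\<And>t s'. t \<le> 50 \<Longrightarrow>
      s' ''I'' 0 = (if s ''b'' x < s ''h'' x then z - T else z - T - s ''w'' x) \<Longrightarrow>
      s' ''M'' 0 = (if s ''b'' x < s ''h'' x then z - T + s ''w'' x else z - T) \<Longrightarrow>
      \<forall>x. x \<notin> {''I'', ''M''} \<longrightarrow> s' x = s x \<Longrightarrow> Q t s'"
  shows "wp index_prog s Q"
  using s by (cases "s ''b'' x < s ''h'' x") (simp_all add: index_prog_def post)

definition choose_prog :: prog where
  "choose_prog =
     set_var ''I'' (Add (Cell ''V'' (var ''I'')) (Const (Suc 0))) ;;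
     set_var ''M'' (Add (Cell ''V'' (var ''M'')) (var ''y'')) ;;
     Cond (Less (var ''e'') (Cell ''a'' (var ''x'')))
       (Cond (Conj (Less (Cell ''b'' (var ''x'')) (Add (var ''e'') (Cell ''h'' (var ''x''))))
                (Less (var ''I'') (var ''M'')))
         (Assign ''V'' (var ''z'') (var ''I'')) (Assign ''V'' (var ''z'') (var ''M'')))
       (Assign ''V'' (var ''z'') (var ''I''))"

lemma writes_choose_prog [simp]: "writes choose_prog = {''I'', ''M'', ''V''}"
  by (auto simp: choose_prog_def)

lemma wp_choose_prog:
  assumes s: "s ''x'' 0 = x" "s ''z'' 0 = z" "s ''e'' 0 = e"
    and ins: "ins = Suc (s ''V'' (s ''I'' 0))" and mat: "mat = s ''V'' (s ''M'' 0) + s ''y'' 0"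
    and post: "\<And>t s'. t \<le> 100 \<Longrightarrow>
      s' ''V'' = (s ''V'')(z :=
        (if e < s ''a'' x then if s ''b'' x < e + s ''h'' x \<and> ins < mat then ins else mat
         else ins)) \<Longrightarrow>
      \<forall>x. x \<notin> {''I'', ''M'', ''V''} \<longrightarrow> s' x = s x \<Longrightarrow> Q t s'"
  shows "wp choose_prog s Q"
proof (cases "e < s ''a'' x")
  case True
  show ?thesis
  proof (cases "s ''b'' x < e + s ''h'' x \<and> ins < mat")
    case True
    with \<open>e < s ''a'' x\<close> s ins mat show ?thesis
      by (simp add: choose_prog_def post)
  next
    case False
    with \<open>e < s ''a'' x\<close> s ins mat show ?thesis
      by (cases "s ''b'' x < e + s ''h'' x") (simp_all add: choose_prog_def post)
  qed
next
  case False
  with s ins mat show ?thesis by (simp add: choose_prog_def post)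
qed

definition cell_prog :: prog where
  "cell_prog =
     set_var ''e'' (Add (Cell ''D'' (var ''x'')) (Sub (Cell ''b'' (var ''x'')) (Cell ''h'' (var ''x'')))) ;;
     set_var ''q'' (Cell ''P'' (Add (Cell ''r'' (var ''e'')) (var ''x''))) ;;
     set_var ''y'' (Const 0) ;;
     crossings_prog ;;
     index_prog ;;
     choose_prog ;;
     odometer_prog ;;
     set_var ''z'' (Add (var ''z'') (Const (Suc 0)))"

lemma writes_cell_prog [simp]:
  "writes cell_prog = {''e'', ''q'', ''y'', ''k'', ''I'', ''M'', ''V'', ''u'', ''D'', ''z''}"
  by (auto simp: cell_prog_def)

context alignment
begin

definition ready :: "state \<Rightarrow> bool" where
  "ready s \<longleftrightarrow> s ''d'' 0 = d \<and> s ''a'' = count_list S \<and>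
     (\<forall>b\<le>d. s ''g'' b = g b \<and> s ''h'' b = r b \<and> s ''w'' b = weight g b) \<and> s ''T'' 0 = T \<and>
     (\<forall>p\<le>length S. s ''r'' p = row d p) \<and>
     counts_upto d S (s ''c'') (length S) \<and> positions_upto d S (s ''P'') (length S)"

definition filled :: "state \<Rightarrow> nat \<Rightarrow> bool" where
  "filled s z \<longleftrightarrow> s ''z'' 0 = z \<and> odometer_shows g d s z \<and> (\<forall>y<z. good y (s ''V'' y))"

lemma wp_cell_prog:
  assumes "ready s" "filled s z" "s ''b'' = pre (Suc i)" "s ''x'' 0 = x"
    and x: "x = L ! (length L - 1 - i)" and i: "i < length L" and z: "z div T = Suc i"
    and post: "\<And>t s'. t \<le> 500 * Suc d \<Longrightarrow> filled s' (Suc z) \<Longrightarrow>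
      \<forall>x. x \<notin> writes cell_prog \<longrightarrow> s' x = s x \<Longrightarrow> Q t s'"
  shows "wp cell_prog s Q"
proof -
  have d: "s ''d'' 0 = d" and a: "s ''a'' = count_list S" and T: "s ''T'' 0 = T"
    using assms(1) by (simp_all add: ready_def)
  have gh: "s ''g'' b = g b" "s ''h'' b = r b" "s ''w'' b = weight g b" if "b \<le> d" for b
    using assms(1) that by (simp_all add: ready_def)
  have D: "s ''D'' b = digit g z b" if "b \<le> d" for b
    using assms(2) that by (simp add: filled_def odometer_shows_def)
  have V: "good y (s ''V'' y)" if "y < z" for y
    using assms(2) that by (simp add: filled_def)
  have zz: "s ''z'' 0 = z"
    using assms(2) by (simp add: filled_def)
  have "x \<in> set L" using x i by simp
  with L_le have "x \<le> d" by auto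
  define e where "e = config z x"
  define q where "q = s ''P'' (s ''r'' e + x)"
  have e: "s ''D'' x + (s ''b'' x - s ''h'' x) = e"
    using \<open>x \<le> d\<close> by (simp add: e_def config_def D gh assms(3) z)
  have q: "q < length S \<and> S ! q = x \<and> count_list (take q S) x = e" if "e < count_list S x"
  proof -
    have "e \<le> length S"
      using that count_le_length[of S x] by linarith
    with assms(1) have "s ''r'' e = row d e" and "positions_upto d S (s ''P'') (length S)"
      by (simp_all add: ready_def)
    with that \<open>x \<le> d\<close> show ?thesis
      by (simp add: q_def positions_upto_def)
  qed
  define Y where "Y = (\<Sum>b\<le>d. s ''c'' (s ''r'' q + b) - (s ''D'' b + (s ''b'' b - s ''h'' b)))"
  have Y: "Y = (\<Sum>b\<le>d. count_list (take q S) b - config z b)" if "e < count_list S x"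
  proof -
    have "q \<le> length S" using q[OF that] by simp
    with assms(1) have "s ''r'' q = row d q" and "counts_upto d S (s ''c'') (length S)"
      by (simp_all add: ready_def)
    with \<open>q \<le> length S\<close> show ?thesis
      unfolding Y_def by (intro sum.cong) (simp_all add: counts_upto_def config_def D gh assms(3) z)
  qed
  define ins where "ins = Suc (s ''V'' (if s ''b'' x < s ''h'' x then z - T else z - T - s ''w'' x))"
  define mat where "mat = s ''V'' (if s ''b'' x < s ''h'' x then z - T + s ''w'' x else z - T) + Y"
  define v where "v = (if e < count_list S x
    then if s ''b'' x < e + s ''h'' x \<and> ins < mat then ins else mat else ins)"
  have "good z v"
    unfolding v_def e_def assms(3) gh(2)[OF \<open>x \<le> d\<close>]
    using q Y by (intro good_step[OF z i x V, where p = q])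
      (simp_all add: ins_def mat_def e_def assms(3) gh \<open>x \<le> d\<close>)
  with V have V': "good y (((s ''V'')(z := v)) y)" if "y < Suc z" for y
    using that by (auto simp: less_Suc_eq)
  have *: "wp odometer_prog s1 (\<lambda>t s2. t \<le> 125 * Suc d \<and> odometer_shows g d s2 (Suc z) \<and>
      (\<forall>x. x \<notin> {''k'', ''u'', ''D''} \<longrightarrow> s2 x = s1 x))"
    if "\<forall>x. x \<notin> {''e'', ''q'', ''y'', ''k'', ''I'', ''M'', ''V''} \<longrightarrow> s1 x = s x" for s1
  proof (rule wp_odometer_prog[where d = d and g = g and z = z])
  qed (use that assms(2) gh(1,3) d in \<open>simp_all add: filled_def odometer_shows_def\<close>)
  show ?thesis
    unfolding cell_prog_def
    apply (simp add: e assms(4) q_def[symmetric])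
    apply (rule wp_crossings_prog)
     apply simp
    apply (rule wp_index_prog[where x = x and z = z and T = T])
       apply (simp_all add: assms(4) zz T)[3]
    apply (rule wp_choose_prog[where ins = ins and mat = mat and x = x and z = z and e = e])
         apply (simp_all add: assms(4) zz T e q_def[symmetric] ins_def mat_def Y_def d)[5]
    subgoal premises prems for t1 s1 t2 s2 t3 s3
    proof -
      have t: "t1 \<le> 125 * Suc d" "t2 \<le> 50" "t3 \<le> 100"
        using prems d by simp_all
      have V3: "s3 ''V'' = (s ''V'')(z := v)"
        using prems by (simp add: v_def a)
      have F3: "\<forall>x. x \<notin> {''e'', ''q'', ''y'', ''k'', ''I'', ''M'', ''V''} \<longrightarrow> s3 x = s x"
        using prems by simp
      show ?thesis
      proof (rule wp_mono[OF *[OF F3]], rule post)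
        fix t s' assume H: "t \<le> 125 * Suc d \<and> odometer_shows g d s' (Suc z) \<and>
          (\<forall>x. x \<notin> {''k'', ''u'', ''D''} \<longrightarrow> s' x = s3 x)"
        then have "s' ''V'' = (s ''V'')(z := v)" "s' ''z'' 0 = z"
          using V3 F3 zz by simp_all
        with H V' show "filled (s'(''z'' := (s' ''z'')(0 := Suc (s' ''z'' 0)))) (Suc z)"
          by (simp add: filled_def odometer_shows_def)
      qed (use t F3 in simp_all)
    qed
    done
qed

end

definition row_prog :: prog where
  "row_prog = For ''j'' (var ''T'') cell_prog"

lemma writes_row_prog [simp]:
  "writes row_prog = {''j'', ''e'', ''q'', ''y'', ''k'', ''I'', ''M'', ''V'', ''u'', ''D'', ''z''}"
  by (auto simp: row_prog_def)

definition dp_prog :: prog where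
  "dp_prog =
     set_var ''T'' (Cell ''w'' (Add (var ''d'') (Const (Suc 0)))) ;;
     set_var ''z'' (var ''T'') ;;
     For ''i'' (var ''m'')
       (set_var ''x'' (Cell ''L'' (Sub (Sub (var ''m'') (Const (Suc 0))) (var ''i''))) ;;
        Assign ''b'' (var ''x'') (Sub (Cell ''b'' (var ''x'')) (Const (Suc 0))) ;;
        row_prog) ;;
     set_var ''out'' (Cell ''V'' (Sub (var ''z'') (var ''T'')))"

lemma digit_mult_weight: "b < a \<Longrightarrow> digit g (k * weight g a) b = 0"
  by (induction k) (simp_all add: add.commute[of "weight g a"] digit_add_weight_higher)

context alignment
begin

lemma wp_row_prog:
  assumes "ready s" "filled s (Suc i * T)" "s ''b'' = pre (Suc i)"
    and x: "s ''x'' 0 = L ! (length L - 1 - i)" and i: "i < length L"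
    and post: "\<And>t s'. t \<le> 600 * (Suc d * T) \<Longrightarrow> filled s' (Suc (Suc i) * T) \<Longrightarrow>
      \<forall>x. x \<notin> writes row_prog \<longrightarrow> s' x = s x \<Longrightarrow> Q t s'"
  shows "wp row_prog s Q"
  unfolding row_prog_def
proof (rule wp_For[where T = "500 * Suc d" and I = "\<lambda>k s'. filled s' (Suc i * T + k)"], goal_cases)
  case 3
  then show ?case using assms(2) by (simp add: filled_def odometer_shows_def)
next
  case (4 k s')
  have T: "s ''T'' 0 = T" using assms(1) by (simp add: ready_def)
  have div: "(Suc i * T + k) div T = Suc i"
    using 4(1) T by (simp add: div_mult_self3 div_add1_eq)
  have R: "ready s'" "s' ''b'' = pre (Suc i)" "s' ''x'' 0 = L ! (length L - 1 - i)"
    using assms(1,3) x 4(4) by (simp_all add: ready_def)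
  show ?case
    by (rule wp_cell_prog[OF R(1) 4(2) R(2,3) refl i div])
      (simp add: filled_def odometer_shows_def)
next
  case (5 t s')
  have T: "s ''T'' 0 = T" using assms(1) by (simp add: ready_def)
  have "1 \<le> T" using weight_pos[of g "Suc d"] by linarith
  define X where "X = Suc d * T"
  have "T \<le> X" by (simp add: X_def)
  moreover have "t \<le> 500 * X + 12 * T + 9"
    using 5(1) T by (simp add: X_def algebra_simps)
  ultimately have "t \<le> 600 * X" using \<open>1 \<le> T\<close> by linarith
  with 5 T show ?case by (intro post) (simp_all add: X_def add.commute)
qed simp_all

lemma good_final:
  assumes "good (length L * T) v"
  shows "enat v = si_cost S L"
proof -
  have "digit g (length L * T) b = 0" for b
  proof (cases "b \<le> d")
    case True
    then show ?thesis by (intro digit_mult_weight) simp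
  next
    case False
    with S_le have "b \<notin> set S" by auto
    then have "g b = 0" by (simp add: gap_def count_list_0_iff)
    then show ?thesis by (simp add: digit_def)
  qed
  then have "config (length L * T) = (\<lambda>_. 0)"
    by (simp add: config_def[abs_def] pre_def)
  with assms show ?thesis
    by (simp add: good_def drop_occ_0)
qed

lemma wp_dp_prog:
  assumes s: "s ''d'' 0 = d" "s ''m'' 0 = length L" "s ''L'' = symbols L" "s ''a'' = count_list S"
      "s ''b'' = count_list L" "\<forall>p\<le>length S. s ''r'' p = row d p"
      "counts_upto d S (s ''c'') (length S)" "positions_upto d S (s ''P'') (length S)"
      "\<forall>b\<le>d. s ''g'' b = g b \<and> s ''h'' b = r b" "\<forall>b\<le>Suc d. s ''w'' b = weight g b"
      "s ''D'' = (\<lambda>_. 0)" "s ''u'' = (\<lambda>_. 0)" "s ''V'' = (\<lambda>_. 0)"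
    and post: "\<And>t s'. t \<le> 700 * (length L * (Suc d * T)) + 50 \<Longrightarrow>
      enat (s' ''out'' 0) = si_cost S L \<Longrightarrow>
      \<forall>x. x \<notin> writes dp_prog \<longrightarrow> s' x = s x \<Longrightarrow> Q t s'"
  shows "wp dp_prog s Q"
proof -
  let ?s = "s(''T'' := (s ''T'')(0 := T), ''z'' := (s ''z'')(0 := T))"
  let ?body = "set_var ''x'' (Cell ''L'' (Sub (Sub (var ''m'') (Const (Suc 0))) (var ''i''))) ;;
        Assign ''b'' (var ''x'') (Sub (Cell ''b'' (var ''x'')) (Const (Suc 0))) ;; row_prog"
  have zero: "T mod weight g b = 0" if "b \<le> d" for b
    using weight_dvd[of b "Suc d" g] that by simp
  have "odometer_shows g d ?s T"
    using s(11,12) zero digit_mult_weight[of _ "Suc d" g 1] by (simp add: odometer_shows_def)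
  then have init: "filled ?s (Suc 0 * T)"
    using good_base s(13) by (simp add: filled_def odometer_shows_def)
  have ready: "ready ?s"
    using s by (simp add: ready_def)
  have pre_0: "pre 0 = count_list L"
    by (simp add: pre_def)
  have "wp (For ''i'' (var ''m'') ?body) ?s (\<lambda>t s'. t \<le> 700 * (length L * (Suc d * T)) + 9 \<and>
      filled s' (Suc (length L) * T) \<and>
      (\<forall>x. x \<notin> insert ''i'' (writes ?body) \<longrightarrow> s' x = ?s x))"
  proof (rule wp_For[where T = "600 * (Suc d * T) + 50" and
      I = "\<lambda>i s'. filled s' (Suc i * T) \<and> s' ''b'' = pre i"], goal_cases)
    case 3
    then show ?case using init s(5) pre_0 by (simp add: filled_def odometer_shows_def)
  next
    case (4 i s')
    then have i: "i < length L" using s(2) by simp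
    let ?x = "L ! (length L - Suc i)"
    have F: "s' ''m'' 0 = length L" "s' ''L'' = symbols L" "s' ''i'' 0 = i" "ready s'"
      "filled s' (Suc i * T)"
      using 4 s ready by (simp_all add: ready_def)
    have "take (length L - i) L = take (length L - Suc i) L @ [?x]"
      using i take_Suc_conv_app_nth[of "length L - Suc i" L] by (simp add: Suc_diff_Suc)
    then have pre: "(s' ''b'')(?x := s' ''b'' ?x - Suc 0) = pre (Suc i)"
      using 4(2) by (auto simp: pre_def fun_eq_iff)
    have sym: "symbols L (length L - Suc i) = ?x"
    proof -
      have "length L - Suc i < length L" using i by linarith
      then show ?thesis by (simp add: symbols_def)
    qed
    show ?case
      apply (simp add: F sym pre)
      apply (rule wp_row_prog[where i = i])
      using F i apply (simp_all add: ready_def filled_def odometer_shows_def sym pre)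
      done
  next
    case (5 t s')
    define X where "X = Suc d * T"
    have "0 < X" using weight_pos[of g "Suc d"] by (simp only: X_def zero_less_Suc nat_0_less_mult_iff simp_thms)
    then have "length L \<le> length L * X" by simp
    moreover have "t \<le> 62 * length L + 600 * (length L * X) + 9"
      using 5(1) s(2) by (simp add: X_def[symmetric] distrib_left mult.left_commute del: mult_Suc)
    ultimately have "t \<le> 700 * (length L * X) + 9"
      by linarith
    with 5 s(2) show ?case by (simp add: X_def)
  qed simp_all
  note loop = this
  have "wp (For ''i'' (var ''m'') ?body) ?s (\<lambda>t s'.
      wp (set_var ''out'' (Cell ''V'' (Sub (var ''z'') (var ''T'')))) s' (\<lambda>u. Q (11 + t + u)))"
  proof (rule wp_mono[OF loop])
    fix t s'
    assume H: "t \<le> 700 * (length L * (Suc d * T)) + 9 \<and> filled s' (Suc (length L) * T) \<and>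
      (\<forall>x. x \<notin> insert ''i'' (writes ?body) \<longrightarrow> s' x = ?s x)"
    then have F: "s' ''T'' 0 = T" "s' ''z'' 0 = Suc (length L) * T"
      by (simp_all add: filled_def)
    have "good (length L * T) (s' ''V'' (length L * T))"
      using H by (simp add: filled_def)
    then have res: "enat (s' ''V'' (length L * T)) = si_cost S L"
      using good_final by blast
    show "wp (set_var ''out'' (Cell ''V'' (Sub (var ''z'') (var ''T'')))) s' (\<lambda>u. Q (11 + t + u))"
      unfolding wp_Assign
    proof (rule post)
    qed (use H F res in \<open>simp_all add: dp_prog_def\<close>)
  qed
  then show ?thesis
    unfolding dp_prog_def using s(1,10)
    by (simp add: eval_nat_numeral)
qed

end

section \<open>The complete algorithm\<close>

definition align_prog :: prog where
  "align_prog = rows_prog ;; tables_prog ;; weights_prog ;; dp_prog"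

lemma (in alignment) wp_align_prog:
  assumes s: "s ''d'' 0 = d" "s ''n'' 0 = length S" "s ''m'' 0 = length L" "s ''S'' = symbols S"
      "s ''L'' = symbols L" "s ''a'' = count_list S" "s ''b'' = count_list L"
    and zero: "\<And>x. x \<in> {''r'', ''c'', ''w'', ''D'', ''u'', ''V''} \<Longrightarrow> s x = (\<lambda>_. 0)"
    and post: "\<And>t s'. t \<le> 500 * (Suc d * Suc (length S)) + 700 * (length L * (Suc d * T)) + 100 \<Longrightarrow>
      enat (s' ''out'' 0) = si_cost S L \<Longrightarrow> s' ''inf'' = s ''inf'' \<Longrightarrow> Q t s'"
  shows "wp align_prog s Q"
  unfolding align_prog_def wp_Seq
proof (rule wp_rows_prog, goal_cases)
  case 1
  then show ?case using zero by simp
next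
  case (2 t1 s1)
  show ?case
  proof (rule wp_tables_prog[OF S_le], goal_cases)
    case (6 t2 s2)
    show ?case
    proof (rule wp_weights_prog, goal_cases)
      case (5 t3 s3)
      show ?case
      proof (rule wp_dp_prog, goal_cases)
        case (14 t4 s4)
        define X Y Z where "X = Suc d * Suc (length S)" and "Y = Suc d * length S"
          and "Z = length L * (Suc d * T)"
        have "length S \<le> X" "Y \<le> X" by (simp_all add: X_def Y_def)
        moreover have "t1 \<le> 30 * length S + 9" using 2(1) s(2) by simp
        moreover have "t2 \<le> 250 * Y + 9" using 6(1) by (simp only: Y_def mult.assoc)
        moreover have "t3 \<le> 150 * X" "t4 \<le> 700 * Z + 50"
          using 5(1) 14(1) by (simp_all only: X_def Z_def)
        ultimately have "t1 + (t2 + (t3 + t4)) \<le> 500 * X + 700 * Z + 100"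
          by linarith
        moreover have "s4 ''inf'' = s ''inf''"
          using 2(3) 6(4) 5(4) 14(3) by (simp add: dp_prog_def)
        ultimately show ?case
          using 14(2) by (intro post) (simp_all add: X_def Z_def)
      qed (use 2 6 5 s zero in simp_all)
    qed (use 2 6 s zero in simp_all)
  qed (use 2 s zero in simp_all)
qed

definition main_prog :: prog where
  "main_prog =
     count_prog ''a'' ''S'' ''n'' ;; count_prog ''b'' ''L'' ''m'' ;; check_prog ;;
     Cond (Less (Const 0) (var ''inf'')) Skip
       (Cond (Less (Const 0) (var ''n'')) align_prog (set_var ''out'' (var ''m'')))"

lemma si_cost_Nil: "si_cost [] L = enat (length L)"
  by (induction L) (simp_all add: zero_enat_def one_enat_def)

lemma gap_le: "2 * gap S L b \<le> count_list L b"
  by (auto simp: gap_def)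

lemma length_le_sum_gap:
  assumes "set L \<subseteq> {1..d}"
  shows "length L \<le> 2 * (\<Sum>b=1..d. count_list L b - gap S L b)"
proof -
  have "length L = (\<Sum>b=1..d. count_list L b)"
    using sum_count_set[OF assms] by simp
  also have "\<dots> \<le> (\<Sum>b=1..d. 2 * (count_list L b - gap S L b))"
  proof (rule sum_mono)
    show "count_list L b \<le> 2 * (count_list L b - gap S L b)" for b
      using gap_le[of S L b] by linarith
  qed
  finally show ?thesis by (simp add: sum_distrib_left)
qed

lemma weight_le_prod_Sigma_plus:
  assumes "d \<ge> 1" "set S \<subseteq> {1..d}" "S \<noteq> []"
  shows "weight (gap S L) (Suc d) \<le> 2 * length S * (\<Prod>b\<in>Sigma_plus d S L. gap S L b + 1)"
proof -
  let ?g = "gap S L"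
  let ?P = "\<Prod>b\<in>Sigma_plus d S L. ?g b + 1"
  have "0 \<notin> set S" using assms(2) by auto
  then have "?g 0 = 0" by (simp add: gap_def count_list_0_iff)
  moreover have "{..<Suc d} = insert 0 {1..d}" by auto
  ultimately have W: "weight ?g (Suc d) = (\<Prod>b\<in>{1..d}. ?g b + 1)"
    by (simp add: weight_def del: prod.lessThan_Suc)
  have n: "1 \<le> length S" using assms(3) by (cases S) simp_all
  show ?thesis
  proof (cases "\<exists>b\<in>{1..d}. ?g b = 0")
    case True
    then have "?P = (\<Prod>b\<in>{1..d}. ?g b + 1)"
      by (intro prod.mono_neutral_left) (auto simp: Sigma_plus_def)
    with W n show ?thesis by simp
  next
    case False
    define b where "b = arg_min_on ?g {1..d}"
    have b: "b \<in> {1..d}"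
      unfolding b_def using assms(1) by (intro arg_min_if_finite(1)) auto
    have Sigma: "Sigma_plus d S L = {1..d} - {b}"
      using False by (auto simp: Sigma_plus_def b_def)
    have "weight ?g (Suc d) = (?g b + 1) * ?P"
      unfolding W Sigma using b by (intro prod.remove) auto
    moreover have "?g b + 1 \<le> 2 * length S"
      using n count_le_length[of S b] by (simp add: gap_def)
    ultimately show ?thesis by (metis mult_le_mono1)
  qed
qed

lemma input_state_simps:
  "input_state d S L ''d'' = scalar d" "input_state d S L ''n'' = scalar (length S)"
  "input_state d S L ''m'' = scalar (length L)" "input_state d S L ''S'' = symbols S"
  "input_state d S L ''L'' = symbols L"
  "x \<notin> {''d'', ''n'', ''m'', ''S'', ''L''} \<Longrightarrow> input_state d S L x = (\<lambda>_. 0)"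
  "scalar k 0 = k"
  by (simp_all add: input_state_def scalar_def)

lemma wp_main_prog:
  assumes d: "d \<ge> 1" and S: "set S \<subseteq> {1..d}" and L: "set L \<subseteq> {1..d}" and n: "length S \<le> length L"
  defines "P \<equiv> \<Prod>b\<in>Sigma_plus d S L. gap S L b + 1"
    and "M \<equiv> \<Sum>b=1..d. count_list L b - gap S L b"
  shows "wp main_prog (input_state d S L) (\<lambda>t s.
    result_of s = si_cost S L \<and>
    (set S \<inter> set L = {} \<longrightarrow> t \<le> 10000 * (d + length L)) \<and>
    (set S \<inter> set L \<noteq> {} \<longrightarrow>
      t \<le> 10000 * (d * (length S + length L) + d^2 * length S * M * P)))"
    (is "wp _ ?s ?Q")
  unfolding main_prog_def wp_Seq
proof (rule wp_count_prog[where w = S], goal_cases)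
  case (5 t1 s1)
  note H1 = this
  show ?case
  proof (rule wp_count_prog[where w = L], goal_cases)
    case (5 t2 s2)
    note H2 = this
    show ?case
    proof (rule wp_check_prog, goal_cases)
      case (2 t3 s3)
      note H3 = this
      let ?n = "length S" and ?m = "length L"
      have F1: "s1 x = ?s x" if "x \<notin> {''i'', ''a''}" for x using H1(3) that by blast
      have F2: "s2 x = s1 x" if "x \<notin> {''i'', ''b''}" for x using H2(3) that by blast
      have F3: "s3 x = s2 x" if "x \<notin> {''i'', ''inf''}" for x using H3(3) that by blast
      have F: "s3 ''a'' = count_list S" "s3 ''b'' = count_list L" "s3 ''d'' 0 = d" "s3 ''n'' 0 = ?n"
        "s3 ''m'' 0 = ?m" "s3 ''S'' = symbols S" "s3 ''L'' = symbols L" "s2 ''d'' 0 = d"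
        "s3 ''out'' = (\<lambda>_. 0)"
        by (simp_all add: F1 F2 F3 H1(2) H2(2) input_state_simps)
      have zero: "s3 x = (\<lambda>_. 0)" if "x \<in> {''r'', ''c'', ''w'', ''D'', ''u'', ''V''}" for x
        using that by (auto simp: F1 F2 F3 input_state_simps)
      have t: "t1 \<le> 22 * ?n + 9" "t2 \<le> 22 * ?m + 9" "t3 \<le> 27 * d + 9"
        using H1(1) H2(1) H3(1) F by simp_all
      have inf: "s3 ''inf'' 0 = 0 \<longleftrightarrow> (\<forall>b\<in>{1..d}. count_list S b \<le> count_list L b)"
        using H3(2) by (simp add: F1 F2 H1(2) H2(2) input_state_simps)
      define Y where "Y = d * (?n + ?m)"
      have Y: "?n \<le> Y" "?m \<le> Y" "d \<le> Y" "1 \<le> Y" if "S \<noteq> []"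
      proof -
        have "1 \<le> ?n" using that by (cases S) simp_all
        then show "d \<le> Y" unfolding Y_def by (cases ?n) simp_all
        with d show "1 \<le> Y" by linarith
        have "1 * (?n + ?m) \<le> Y" unfolding Y_def using d by (rule mult_le_mono1)
        then show "?n \<le> Y" "?m \<le> Y" by simp_all
      qed
      show ?case
      proof (cases "s3 ''inf'' 0 = 0")
        case False
        with inf obtain b where "\<not> count_list S b \<le> count_list L b" by blast
        then have "si_cost S L = \<infinity>" using count_list_le_if_si_cost[of S L b] by blast
        moreover have "t1 + (t2 + (t3 + 10)) \<le> 10000 * (d + ?m)"
          using t n d by simp
        moreover have "t1 + (t2 + (t3 + 10)) \<le> 10000 * (Y + d^2 * ?n * M * P)"
          if "set S \<inter> set L \<noteq> {}"
          using Y t that by (cases "S = []") auto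
        ultimately show ?thesis
          using False by (cases "set S \<inter> set L = {}") (simp_all add: result_of_def Y_def)
      next
        case inf0: True
        show ?thesis
        proof (cases "S = []")
          case True
          have "t1 + (t2 + (t3 + 20)) \<le> 10000 * (d + ?m)"
            using t n d by simp
          with True inf0 F show ?thesis
            by (simp add: result_of_def si_cost_Nil)
        next
          case False
          have le: "count_list S b \<le> count_list L b" for b
          proof (cases "b \<in> {1..d}")
            case True
            with inf inf0 show ?thesis by blast
          next
            case False
            with S have "b \<notin> set S" by blast
            then show ?thesis by (simp add: count_list_0_iff)
          qed
          interpret alignment d S L
            by unfold_locales (use S L le in auto)
          have common: "set S \<inter> set L \<noteq> {}"
            using False le[of "hd S"] by (metis count_list_0_iff disjoint_iff hd_in_set le_zero_eq)
          have "T \<le> 2 * ?n * P"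
            unfolding P_def using d S False by (rule weight_le_prod_Sigma_plus)
          moreover have "?m \<le> 2 * M"
            unfolding M_def using L by (rule length_le_sum_gap)
          moreover have "Suc d \<le> 2 * d" using d by simp
          ultimately have "?m * (Suc d * T) \<le> (2 * M) * ((2 * d) * (2 * ?n * P))"
            by (intro mult_le_mono)
          also have "\<dots> = 8 * (d * (?n * M * P))" by simp
          also have "\<dots> \<le> 8 * (d^2 * ?n * M * P)"
            using d by (simp add: power2_eq_square)
          finally have dp: "?m * (Suc d * T) \<le> 8 * (d^2 * ?n * M * P)" .
          have "Suc ?n \<le> 2 * ?n" using False by (cases S) simp_all
          with \<open>Suc d \<le> 2 * d\<close> have "Suc d * Suc ?n \<le> (2 * d) * (2 * ?n)"
            by (intro mult_le_mono)
          also have "\<dots> \<le> 4 * Y" by (simp add: Y_def)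
          finally have tables: "Suc d * Suc ?n \<le> 4 * Y" .
          have align: "wp align_prog s3 (\<lambda>u. ?Q (t1 + (t2 + (t3 + (10 + u)))))"
          proof (rule wp_align_prog, goal_cases)
            case (9 t s)
            define Z W X where "Z = d^2 * ?n * M * P" and "W = ?m * (Suc d * T)"
              and "X = Suc d * Suc ?n"
            have "t \<le> 500 * X + 700 * W + 100" "W \<le> 8 * Z" "X \<le> 4 * Y"
              using 9(1) dp tables by (simp_all only: X_def W_def Z_def)
            then have "t1 + (t2 + (t3 + (10 + t))) \<le> 10000 * (Y + Z)"
              using t Y[OF False] by simp
            moreover have "result_of s = si_cost S L"
              using 9(2,3) inf0 by (simp add: result_of_def)
            ultimately show ?case
              using common unfolding Y_def Z_def by blast
          qed (simp_all add: F zero)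
          have "wp (Cond (Less (Const 0) (var ''inf'')) Skip
              (Cond (Less (Const 0) (var ''n'')) align_prog (set_var ''out'' (var ''m''))))
              s3 (\<lambda>u. R (t1 + (t2 + (t3 + u))))"
            if "wp align_prog s3 (\<lambda>u. R (t1 + (t2 + (t3 + (10 + u)))))" for R
            using that inf0 False F by (simp add: eval_nat_numeral)
          from this[of ?Q, OF align] show ?thesis .
        qed
      qed
    qed (simp add: H2 H1 input_state_simps)
  qed (use H1 in \<open>simp_all add: input_state_simps\<close>)
qed (simp_all add: input_state_simps)

theorem theorem1:
  "\<exists>(p :: prog) (C :: nat). \<forall>(d :: nat) (S :: nat list) (L :: nat list).
     d \<ge> 1 \<longrightarrow> set S \<subseteq> {1..d} \<longrightarrow> set L \<subseteq> {1..d} \<longrightarrow> length S \<le> length L \<longrightarrow>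
     (\<exists>t s. exec p (input_state d S L) t s \<and>
        result_of s = swap_insert_dist S L \<and>
        (set S \<inter> set L = {} \<longrightarrow> t \<le> C * (d + length L)) \<and>
        (set S \<inter> set L \<noteq> {} \<longrightarrow>
           t \<le> C * (d * (length S + length L) +
                    d^2 * length S * (\<Sum>\<alpha>=1..d. (count_list L \<alpha> - gap S L \<alpha>)) *
                      (\<Prod>\<alpha>\<in>Sigma_plus d S L. (gap S L \<alpha> + 1)))))"
proof (rule exI[of _ main_prog], rule exI[of _ 10000], intro allI impI)
  fix d :: nat and S L :: "nat list"
  assume "d \<ge> 1" "set S \<subseteq> {1..d}" "set L \<subseteq> {1..d}" "length S \<le> length L"
  from wp_main_prog[OF this]
  show "\<exists>t s. exec main_prog (input_state d S L) t s \<and> result_of s = swap_insert_dist S L \<and>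
      (set S \<inter> set L = {} \<longrightarrow> t \<le> 10000 * (d + length L)) \<and>
      (set S \<inter> set L \<noteq> {} \<longrightarrow>
         t \<le> 10000 * (d * (length S + length L) +
           d^2 * length S * (\<Sum>\<alpha>=1..d. (count_list L \<alpha> - gap S L \<alpha>)) *
             (\<Prod>\<alpha>\<in>Sigma_plus d S L. (gap S L \<alpha> + 1))))"
    unfolding wp_def swap_insert_dist_eq_si_cost by blast
qed

end
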